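(* Let $n\in\mathbb{N}$ and let $i\in\mathbb{N}$ with $2\le i\le 2^n$. If $i\le 2^{n-1}$, then $\rho(\mathcal{L}_i^n,\mathcal{L}_{i+1}^n)=\infty$. If $i>2^{n-1}$, then $\rho(\mathcal{L}_i^n,\mathcal{L}_*^n)\le 4\operatorname{Flt}(n)$.
   Context: $\mathcal{C}^n$ is the family of all $n$-dimensional closed convex subsets of $\mathbb{R}^n$. A set $B\subseteq\mathbb{R}^n$ is lattice-free if $B\in\mathcal{C}^n$ and $\operatorname{int}(B)\cap\mathbb{Z}^n=\emptyset$. For $i\in\mathbb{N}$, $\mathcal{L}_i^n$ is the family of all lattice-free polyhedra in $\mathbb{R}^n$ with at most $i$ facets, and $\mathcal{L}_*^n$ is the family of all lattice-free polyhedra in $\mathbb{R}^n$. For $B\in\mathcal{C}^n$ with $0\in\operatorname{int}(B)$, the gauge function is $\psi_B(r)=\inf\{\lambda>0: r\in\lambda B\}$. For $k\in\mathbb{N}$, $R=(r_1,\dots,r_k)\in\mathbb{R}^{n\times k}$, $f\in\mathbb{R}^n\setminus\mathbb{Z}^n$ and $B\in\mathcal{C}^n$: if $f\in\operatorname{int}(B)$, $C_B(R,f)=\{s\in\mathbb{R}^k_{\ge0}:\sum_{j=1}^k s_j\psi_{B-f}(r_j)\ge1\}$; otherwise $C_B(R,f)=\mathbb{R}^k_{\ge0}$. For a family $\mathcal{B}\subseteq\mathcal{C}^n$, $C_{\mathcal{B}}(R,f)=\bigcap_{B\in\mathcal{B}}C_B(R,f)$ (equal to $\mathbb{R}^k_{\ge0}$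 if $\mathcal{B}=\emptyset$). For families $\mathcal{B},\mathcal{L}\subseteq\mathcal{C}^n$ and $f\in\mathbb{R}^n\setminus\mathbb{Z}^n$, $\rho_f(\mathcal{B},\mathcal{L})=\inf\{\alpha>0: C_{\mathcal{B}}(R,f)\subseteq\frac1\alpha C_{\mathcal{L}}(R,f)$ for all $k\in\mathbb{N}$ and all $R\in\mathbb{R}^{n\times k}\}$, and $\rho(\mathcal{B},\mathcal{L})=\sup\{\rho_f(\mathcal{B},\mathcal{L}):f\in\mathbb{R}^n\setminus\mathbb{Z}^n\}$. The lattice width of a nonempty $X\subseteq\mathbb{R}^n$ is $w(X)=\inf_{u\in\mathbb{Z}^n\setminus\{0\}}(\sup_{x\in X}u\cdot x-\inf_{x\in X}u\cdot x)$, and the flatness constant is $\operatorname{Flt}(n)=\sup\{w(B): B \text{ lattice-free in } \mathbb{R}^n\}$ (which is finite). *)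

theory Defs
  imports "HOL-Analysis.Analysis" "HOL-Library.Extended_Real"
begin

definition int_lattice :: "(real^'n) set" where
  "int_lattice = {x. \<forall>k. x $ k \<in> \<int>}"

definition full_closed_convex :: "(real^'n) set \<Rightarrow> bool" where
  "full_closed_convex B \<longleftrightarrow> closed B \<and> convex B \<and> aff_dim B = int CARD('n)"

definition lattice_free :: "(real^'n) set \<Rightarrow> bool" where
  "lattice_free B \<longleftrightarrow> full_closed_convex B \<and> interior B \<inter> int_lattice = {}"

definition Lfree_poly :: "nat \<Rightarrow> (real^'n) set set" where
  "Lfree_poly i = {B. lattice_free B \<and> polyhedron B \<and> finite {F. F facet_of B}
                       \<and> card {F. F facet_of B} \<le> i}"

definition Lfree_poly_all :: "(real^'n) set set" where
  "Lfree_poly_all = {B. lattice_free B \<and> polyhedron B}"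

definition gauge_fn :: "(real^'n) set \<Rightarrow> real^'n \<Rightarrow> real" where
  "gauge_fn B r = Inf {t::real. t > 0 \<and> r \<in> (\<lambda>x. t *\<^sub>R x) ` B}"

text \<open>Vectors s in R^k are modelled as functions nat => real vanishing outside {..<k};
  a matrix R in R^(n x k) as its columns r_0,...,r_(k-1).\<close>
definition nonneg_orthant :: "nat \<Rightarrow> (nat \<Rightarrow> real) set" where
  "nonneg_orthant k = {s. (\<forall>j<k. s j \<ge> 0) \<and> (\<forall>j\<ge>k. s j = 0)}"

definition C_set :: "(real^'n) set \<Rightarrow> nat \<Rightarrow> (nat \<Rightarrow> real^'n) \<Rightarrow> real^'n \<Rightarrow> (nat \<Rightarrow> real) set" where
  "C_set B k R f =
     (if f \<in> interior B
      then {s \<in> nonneg_orthant k. (\<Sum>j<k. s j * gauge_fn ((\<lambda>x. x - f) ` B) (R j)) \<ge> 1}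
      else nonneg_orthant k)"

definition C_fam :: "(real^'n) set set \<Rightarrow> nat \<Rightarrow> (nat \<Rightarrow> real^'n) \<Rightarrow> real^'n \<Rightarrow> (nat \<Rightarrow> real) set" where
  "C_fam \<B> k R f = nonneg_orthant k \<inter> (\<Inter>B\<in>\<B>. C_set B k R f)"

definition rho_f :: "(real^'n) set set \<Rightarrow> (real^'n) set set \<Rightarrow> real^'n \<Rightarrow> ereal" where
  "rho_f \<B> \<L> f = Inf {ereal \<alpha> | \<alpha>. \<alpha> > 0 \<and>
      (\<forall>k R. C_fam \<B> k R f \<subseteq> (\<lambda>s j. s j / \<alpha>) ` C_fam \<L> k R f)}"

definition rho :: "(real^'n) set set \<Rightarrow> (real^'n) set set \<Rightarrow> ereal" where
  "rho \<B> \<L> = (SUP f \<in> UNIV - int_lattice. rho_f \<B> \<L> f)"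

definition lattice_width :: "(real^'n) set \<Rightarrow> ereal" where
  "lattice_width X = (INF u \<in> int_lattice - {0}.
      (SUP x \<in> X. ereal (u \<bullet> x)) - (INF x \<in> X. ereal (u \<bullet> x)))"

definition Flt :: "'n::finite itself \<Rightarrow> ereal" where
  "Flt _ = (SUP B \<in> {B :: (real^'n) set. lattice_free B}. lattice_width B)"

end

theory Submission
  imports Defs
begin

text \<open>For \<open>i > 2 ^ (n - 1)\<close>, let \<open>B\<close> be lattice-free and let \<open>u\<close> be an integer direction in which
  \<open>B\<close> has width at most \<open>Flt\<close>. The copy of \<open>B\<close> shrunk towards \<open>f\<close> by \<open>4 * Flt\<close> meets at most one lattice
  layer \<open>u \<bullet> x = k\<close>. By Doignon's theorem, \<open>2 ^ (n - 1)\<close> of the half-spaces of \<open>B\<close> cut off all lattice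
  points of this layer. Tilted around their traces in the layer and truncated at the next layer, they
  form a lattice-free set with one more facet that contains the shrunken copy.

  For \<open>i \<le> 2 ^ (n - 1)\<close>, partition the vertices of an \<open>(n - 1)\<close>-dimensional cube into \<open>i\<close> faces. They
  define a lattice-free base polyhedron with \<open>i\<close> facets in one layer, each with a private lattice point
  on it, and a flat pyramid \<open>B\<close> over it with \<open>f\<close> just below the apex. A lattice-free set with \<open>i\<close> facets
  containing the points of a shrunken copy of \<open>B\<close> spends all its facets on the base, hence contains the
  whole downward cone and lattice points in its interior.\<close>

subsection \<open>Gauge functions\<close>

text \<open>Tilting is endangered by the layers below \<open>k\<close>: their lattice points are no
  longer cut off by the half-spaces that were dropped. Some convex combination of the chosen normals
  is a multiple of \<open>u\<close>, so the tilted inequalities combine into one in the height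
  alone, which excludes all those layers once the tilts are steep enough; containment of the
  shrunken copy limits the tilts from the other side. Both demands can be met under an inequality
  between the shrinking factor, the height of \<open>f\<close> and the extents of \<open>B\<close>
  above and below the layer. If \<open>B\<close> reaches further below than above, the direction is
  reversed. Then \<open>f\<close> lies up to 1/2 towards the closing side of the cone, and this case
  is where the constant 4 is used up.

  In the lower bound, the directions from \<open>f\<close> to the test points are recession
  directions of the pyramid without its bottom facet. Flattening the pyramid makes room above the
  bottom, so the test points can be pushed out by any prescribed factor without leaving
  \<open>B\<close>.\<close>

lemma gauge_fn_translate:
  "gauge_fn ((\<lambda>x. x - f) ` B) r = Inf {t. t > 0 \<and> f + (1 / t) *\<^sub>R r \<in> B}"
proof -
  have "r \<in> (\<lambda>x. t *\<^sub>R x) ` ((\<lambda>x. x - f) ` B) \<longleftrightarrow> f + (1 / t) *\<^sub>R r \<in> B" if "t > 0" for t :: real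
  proof
    assume "r \<in> (\<lambda>x. t *\<^sub>R x) ` ((\<lambda>x. x - f) ` B)"
    then show "f + (1 / t) *\<^sub>R r \<in> B"
      using that by (auto simp: image_iff)
  next
    assume "f + (1 / t) *\<^sub>R r \<in> B"
    moreover have "r = t *\<^sub>R ((f + (1 / t) *\<^sub>R r) - f)"
      using that by simp
    ultimately show "r \<in> (\<lambda>x. t *\<^sub>R x) ` ((\<lambda>x. x - f) ` B)"
      by blast
  qed
  then show ?thesis
    unfolding gauge_fn_def by (intro arg_cong[where f = Inf]) blast
qed

lemma gauge_set_nonempty:
  fixes f r :: "'a::real_normed_vector"
  assumes "f \<in> interior B"
  shows "{t::real. t > 0 \<and> f + (1 / t) *\<^sub>R r \<in> B} \<noteq> {}"
proof -
  obtain e where e: "e > 0" "ball f e \<subseteq> B"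
    using assms mem_interior by blast
  define t where "t = (norm r + 1) / e"
  have t: "t > 0"
    unfolding t_def using e(1) by (simp add: add_nonneg_pos)
  have "norm r / t = e * (norm r / (norm r + 1))"
    unfolding t_def by simp
  also have "\<dots> < e * 1"
    using e(1) by (intro mult_strict_left_mono) (simp_all add: add_nonneg_pos)
  finally have "f + (1 / t) *\<^sub>R r \<in> ball f e"
    using t by (simp add: dist_norm)
  then show ?thesis
    using e(2) t by blast
qed

text \<open>If \<open>f + (1 / t) *\<^sub>R r\<close> lies in \<open>B\<close>, then its shrunken
  image \<open>f + (1 / (\<alpha> * t)) *\<^sub>R r\<close> lies in \<open>L\<close>; so \<alpha>
  times a feasible scalar for \<open>B\<close> is feasible for \<open>L\<close>.\<close>

lemma gauge_fn_le_scaled: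
  fixes f :: "real^'n"
  assumes "\<alpha> > 0" "f \<in> interior B"
    and sub: "\<And>x. x \<in> B \<Longrightarrow> f + (1 / \<alpha>) *\<^sub>R (x - f) \<in> L"
  shows "gauge_fn ((\<lambda>x. x - f) ` L) r \<le> \<alpha> * gauge_fn ((\<lambda>x. x - f) ` B) r"
proof -
  let ?T = "\<lambda>S. {t::real. t > 0 \<and> f + (1 / t) *\<^sub>R r \<in> S}"
  have bdd: "bdd_below (?T L)"
    by (rule bdd_belowI[where m = 0]) auto
  have "Inf (?T L) / \<alpha> \<le> Inf (?T B)"
  proof (rule cInf_greatest)
    show "?T B \<noteq> {}"
      using gauge_set_nonempty[OF assms(2)] .
    fix t assume t: "t \<in> ?T B"
    then have "f + (1 / \<alpha>) *\<^sub>R ((f + (1 / t) *\<^sub>R r) - f) \<in> L"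
      using sub by blast
    then have "\<alpha> * t \<in> ?T L"
      using t assms(1) by simp
    then have "Inf (?T L) \<le> \<alpha> * t"
      using bdd by (rule cInf_lower)
    then show "Inf (?T L) / \<alpha> \<le> t"
      using assms(1) by (simp add: field_simps)
  qed
  then show ?thesis
    unfolding gauge_fn_translate using assms(1) by (simp add: field_simps)
qed

lemma gauge_fn_nonneg:
  assumes "f \<in> interior B"
  shows "gauge_fn ((\<lambda>x. x - f) ` B) r \<ge> 0"
  unfolding gauge_fn_translate
  by (rule cInf_greatest[OF gauge_set_nonempty[OF assms]]) auto

text \<open>A feasible \<open>t < s\<close> would put the point at parameter \<open>1 / s\<close> on
  the segment from \<open>f\<close> to the point at \<open>1 / t\<close>, hence in
  \<open>B\<close>.\<close>

lemma gauge_fn_ge: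
  fixes f :: "real^'n"
  assumes "convex B" "f \<in> interior B" "s > 0" "f + (1 / s) *\<^sub>R r \<notin> B"
  shows "gauge_fn ((\<lambda>x. x - f) ` B) r \<ge> s"
  unfolding gauge_fn_translate
proof (rule cInf_greatest[OF gauge_set_nonempty[OF assms(2)]])
  fix t assume t: "t \<in> {t. 0 < t \<and> f + (1 / t) *\<^sub>R r \<in> B}"
  show "s \<le> t"
  proof (rule ccontr)
    assume "\<not> s \<le> t"
    moreover have "f \<in> B"
      using assms(2) interior_subset by blast
    moreover have "f + (1 / s) *\<^sub>R r = (1 - t / s) *\<^sub>R f + (t / s) *\<^sub>R (f + (1 / t) *\<^sub>R r)"
      using t by (simp add: algebra_simps)
    ultimately have "f + (1 / s) *\<^sub>R r \<in> B"
      using t assms(1,3) by (auto intro!: convexD_alt)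
    then show False
      using assms(4) by simp
  qed
qed

lemma gauge_fn_le:
  assumes "f + r \<in> B"
  shows "gauge_fn ((\<lambda>x. x - f) ` B) r \<le> 1"
  unfolding gauge_fn_translate
  by (rule cInf_lower) (use assms in \<open>auto intro!: bdd_belowI[where m = 0]\<close>)

subsection \<open>Facets and half-spaces\<close>

lemma interior_halfspaces:
  fixes a :: "'j \<Rightarrow> 'a::euclidean_space"
  assumes "finite J" "\<And>j. j \<in> J \<Longrightarrow> a j \<noteq> 0"
  shows "interior {x. \<forall>j\<in>J. a j \<bullet> x \<le> b j} = {x. \<forall>j\<in>J. a j \<bullet> x < b j}"
proof -
  have "{x. \<forall>j\<in>J. a j \<bullet> x \<le> b j} = (\<Inter>j\<in>J. {x. a j \<bullet> x \<le> b j})"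
    by auto
  moreover have "interior (\<Inter>j\<in>J. {x. a j \<bullet> x \<le> b j}) = (\<Inter>j\<in>J. interior {x. a j \<bullet> x \<le> b j})"
    using assms(1)
  proof (induction J rule: finite_induct)
    case (insert j J)
    then show ?case by (simp add: interior_Int)
  qed simp
  ultimately show ?thesis
    using assms(2) by auto
qed

text \<open>A subfamily of least cardinality that describes the same set is irredundant, so every
  facet is the trace of one of its bounding hyperplanes. The nonempty interior makes the affine hull
  the whole space.\<close>

lemma
  fixes a :: "'j \<Rightarrow> 'a::euclidean_space"
  assumes J: "finite J" "\<And>j. j \<in> J \<Longrightarrow> a j \<noteq> 0"
    and S: "S = {x. \<forall>j\<in>J. a j \<bullet> x \<le> b j}"
    and int: "interior S \<noteq> {}"
  shows polyhedron_halfspaces: "polyhedron S"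
    and finite_facets_halfspaces: "finite {C. C facet_of S}"
    and card_facets_halfspaces: "card {C. C facet_of S} \<le> card J"
proof -
  define hs where "hs j = {x. a j \<bullet> x \<le> b j}" for j
  have S': "S = \<Inter> (hs ` J)"
    unfolding S hs_def by auto
  define P where "P F \<longleftrightarrow> F \<subseteq> J \<and> S = \<Inter> (hs ` F)" for F
  have "P J"
    using S' by (simp add: P_def)
  then obtain F where "P F" and min: "\<forall>F'. P F' \<longrightarrow> card F \<le> card F'"
    using ex_has_least_nat[of P J card] by blast
  then have F: "F \<subseteq> J" "S = \<Inter> (hs ` F)"
    and Fmin: "\<And>F'. F' \<subseteq> J \<Longrightarrow> S = \<Inter> (hs ` F') \<Longrightarrow> card F \<le> card F'"
    by (simp_all add: P_def)
  have finF: "finite F"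
    using F(1) J(1) finite_subset by blast
  show poly: "polyhedron S"
    unfolding polyhedron_def
  proof (intro exI[of _ "hs ` J"] conjI ballI)
    show "\<exists>a b. a \<noteq> 0 \<and> h = {x. a \<bullet> x \<le> b}" if "h \<in> hs ` J" for h
      using that J(2) unfolding hs_def by blast
  qed (use S' J(1) in auto)
  then show finfac: "finite {C. C facet_of S}"
    by (rule finite_polyhedron_facets)
  have aff: "affine hull S = UNIV"
    using int affine_hull_nonempty_interior by blast
  have inj: "inj_on hs F"
  proof (rule inj_onI, rule ccontr)
    fix i j assume ij: "i \<in> F" "j \<in> F" "hs i = hs j" "i \<noteq> j"
    then have "\<Inter> (hs ` F) = \<Inter> (hs ` (F - {j}))"
      by auto
    then have "card F \<le> card (F - {j})"
      using F by (intro Fmin) auto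
    then show False
      using card_Diff1_less[OF finF ij(2)] by simp
  qed
  define g where "g = the_inv_into F hs"
  have g: "g h \<in> F" "hs (g h) = h" if "h \<in> hs ` F" for h
    using that inj unfolding g_def by (simp_all add: the_inv_into_into f_the_inv_into_f)
  have "C facet_of S \<longleftrightarrow> (\<exists>h. h \<in> hs ` F \<and> C = S \<inter> {x. a (g h) \<bullet> x = b (g h)})" for C
  proof (rule facet_of_polyhedron_explicit)
    show "finite (hs ` F)" using finF by simp
    show "S = affine hull S \<inter> \<Inter> (hs ` F)" using F(2) aff by simp
    show "a (g h) \<noteq> 0 \<and> h = {x. a (g h) \<bullet> x \<le> b (g h)}" if "h \<in> hs ` F" for h
      using g[OF that] F(1) J(2) unfolding hs_def by blast
    show "S \<subset> affine hull S \<inter> \<Inter> H" if H: "H \<subset> hs ` F" for H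
    proof -
      obtain F' where F': "F' \<subseteq> F" "H = hs ` F'"
        using H by (meson psubset_imp_subset subset_imageE)
      have "F' \<subset> F" using F' H by auto
      then have "card F' < card F" using finF psubset_card_mono by blast
      moreover have "F' \<subseteq> J" using F'(1) F(1) by simp
      ultimately have "S \<noteq> \<Inter> H" using Fmin[of F'] F'(2) not_le by blast
      moreover have "S \<subseteq> \<Inter> H" unfolding F(2) F'(2) using F'(1) by blast
      ultimately show ?thesis unfolding aff Int_UNIV_left by (simp only: psubset_eq) simp
    qed
  qed
  then have "{C. C facet_of S} \<subseteq> (\<lambda>h. S \<inter> {x. a (g h) \<bullet> x = b (g h)}) ` hs ` F"
    by blast
  then have "card {C. C facet_of S} \<le> card ((\<lambda>h. S \<inter> {x. a (g h) \<bullet> x = b (g h)}) ` hs ` F)"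
    by (rule card_mono[rotated]) (use finF in blast)
  also have "\<dots> \<le> card (hs ` F)"
    by (rule card_image_le) (use finF in blast)
  also have "\<dots> \<le> card F"
    by (rule card_image_le[OF finF])
  also have "\<dots> \<le> card J"
    using F(1) J(1) card_mono by blast
  finally show "card {C. C facet_of S} \<le> card J" .
qed

lemma Lfree_poly_halfspaces:
  fixes a :: "'j \<Rightarrow> real^'n"
  assumes "finite J" "card J \<le> i"
    and f: "\<And>j. j \<in> J \<Longrightarrow> a j \<bullet> f < b j"
    and free: "\<And>z. z \<in> int_lattice \<Longrightarrow> \<exists>j\<in>J. a j \<bullet> z \<ge> b j"
  shows "{x. \<forall>j\<in>J. a j \<bullet> x \<le> b j} \<in> Lfree_poly i"
proof -
  define J' where "J' = {j \<in> J. a j \<noteq> 0}"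
  have zero: "b j > 0" if "j \<in> J" "j \<notin> J'" for j
    using f that by (force simp: J'_def)
  have eq: "{x. \<forall>j\<in>J. a j \<bullet> x \<le> b j} = {x. \<forall>j\<in>J'. a j \<bullet> x \<le> b j}" (is "_ = ?S")
  proof -
    have "a j \<bullet> x \<le> b j" if "j \<in> J" "\<forall>j\<in>J'. a j \<bullet> x \<le> b j" for j x
      using that zero[of j] by (cases "j \<in> J'") (auto simp: J'_def)
    then show ?thesis
      by (auto simp: J'_def)
  qed
  have J': "finite J'" "\<And>j. j \<in> J' \<Longrightarrow> a j \<noteq> 0"
    using assms(1) by (auto simp: J'_def)
  have int: "interior ?S = {x. \<forall>j\<in>J'. a j \<bullet> x < b j}"
    using J' by (intro interior_halfspaces)
  have "f \<in> interior ?S"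
    unfolding int using f by (simp add: J'_def)
  then have ne: "interior ?S \<noteq> {}"
    by blast
  note poly = polyhedron_halfspaces[OF J' refl ne] finite_facets_halfspaces[OF J' refl ne]
    card_facets_halfspaces[OF J' refl ne]
  have "card J' \<le> card J"
    using assms(1) by (intro card_mono) (auto simp: J'_def)
  then have card: "card {C. C facet_of ?S} \<le> i"
    using poly(3) assms(2) by linarith
  have "z \<notin> interior ?S" if z: "z \<in> int_lattice" for z
  proof -
    obtain j where j: "j \<in> J" "b j \<le> a j \<bullet> z"
      using free[OF z] by blast
    then have "j \<in> J'"
      using zero[of j] by (cases "j \<in> J'") (auto simp: J'_def)
    then show ?thesis
      unfolding int using j(2) by (auto simp: not_less)
  qed
  then have "interior ?S \<inter> int_lattice = {}"
    by blast
  moreover have "aff_dim ?S = int CARD('n)"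
    using ne aff_dim_nonempty_interior by fastforce
  ultimately show ?thesis
    unfolding Lfree_poly_def lattice_free_def full_closed_convex_def eq
    using poly card polyhedron_imp_closed[OF poly(1)] polyhedron_imp_convex[OF poly(1)] by simp
qed

text \<open>Turns a bound on the number of facets into a bound on the number of inequalities. A
  segment from an interior point to a point outside \<open>S\<close> meets the frontier, hence a
  facet; its inequality is strict at the interior end and tight at the crossing, so it fails at the
  outer end.\<close>

lemma polyhedron_facet_halfspaces:
  fixes S :: "'a::euclidean_space set"
  assumes "polyhedron S" "interior S \<noteq> {}"
  obtains a b where "\<And>C. C facet_of S \<Longrightarrow> a C \<noteq> 0" "S = {x. \<forall>C. C facet_of S \<longrightarrow> a C \<bullet> x \<le> b C}"
proof -
  have "\<forall>C. \<exists>a b. C facet_of S \<longrightarrow> a \<noteq> 0 \<and> S \<subseteq> {x. a \<bullet> x \<le> b} \<and> C = S \<inter> {x. a \<bullet> x = b}"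
    using facet_of_polyhedron[OF assms(1)] by metis
  then obtain a b where ab: "\<And>C. C facet_of S \<Longrightarrow>
      a C \<noteq> 0 \<and> S \<subseteq> {x. a C \<bullet> x \<le> b C} \<and> C = S \<inter> {x. a C \<bullet> x = b C}"
    by metis
  have "x \<in> S" if x: "\<And>C. C facet_of S \<Longrightarrow> a C \<bullet> x \<le> b C" for x
  proof (rule ccontr)
    assume "x \<notin> S"
    obtain z where z: "z \<in> interior S"
      using assms(2) by blast
    have "closed_segment z x \<inter> frontier S \<noteq> {}"
      using z \<open>x \<notin> S\<close> interior_subset by (intro connected_Int_frontier) auto
    then obtain y where y: "y \<in> closed_segment z x" "y \<in> frontier S"
      by blast
    have "closed S" using assms(1) by (rule polyhedron_imp_closed)
    then have "y \<in> S" using y(2) by (simp add: frontier_def)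
    have "rel_frontier S = frontier S"
      using assms(2) by (simp add: rel_frontier_nonempty_interior)
    then obtain C where C: "C facet_of S" "y \<in> C"
      using y(2) rel_frontier_of_polyhedron[OF assms(1)] by blast
    then have eq: "a C \<bullet> y = b C" using ab by blast
    have "interior S \<subseteq> interior {x. a C \<bullet> x \<le> b C}"
      using ab[OF C(1)] by (intro interior_mono) blast
    then have "a C \<bullet> z < b C" using z ab[OF C(1)] by auto
    obtain u where u: "0 \<le> u" "u \<le> 1" "y = (1 - u) *\<^sub>R z + u *\<^sub>R x"
      using y(1) by (auto simp: in_segment)
    have "u \<noteq> 1" using u(3) \<open>y \<in> S\<close> \<open>x \<notin> S\<close> by auto
    then have "(1 - u) * (a C \<bullet> z) < (1 - u) * b C" using u(2) \<open>a C \<bullet> z < b C\<close> by simp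
    moreover have "u * (a C \<bullet> x) \<le> u * b C" using x[OF C(1)] u(1) by (simp add: mult_left_mono)
    moreover have "a C \<bullet> y = (1 - u) * (a C \<bullet> z) + u * (a C \<bullet> x)"
      using u(3) by (simp add: inner_add_right)
    ultimately have "a C \<bullet> y < b C" by (simp add: algebra_simps)
    then show False using eq by simp
  qed
  then have "S = {x. \<forall>C. C facet_of S \<longrightarrow> a C \<bullet> x \<le> b C}"
    using ab by blast
  then show thesis
    using that ab by blast
qed

subsection \<open>Integer points of a lattice layer\<close>

text \<open>Thresholds are raised one at a time, that of \<open>j\<close> to the least value of
  \<open>a j\<close> on the points that \<open>j\<close> alone cuts off. These points stay cut off,
  all others are cut off by another index, and a raise only adds slack for the remaining indices, so
  irredundancy and the tightness reached earlier survive. \<open>T\<close> collects the indices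
  already made tight.\<close>

lemma tight_system:
  fixes a :: "'j \<Rightarrow> 'a::real_inner"
  assumes "finite S" "finite J" "T \<subseteq> J"
    and cover: "\<And>x. x \<in> S \<Longrightarrow> \<exists>j\<in>J. b j \<le> a j \<bullet> x"
    and minimal: "\<And>j. j \<in> J \<Longrightarrow> \<exists>x\<in>S. \<forall>i\<in>J - {j}. a i \<bullet> x < b i"
  shows "\<exists>b'. (\<forall>x\<in>S. \<exists>j\<in>J. b' j \<le> a j \<bullet> x) \<and>
     (\<forall>j\<in>J. \<exists>x\<in>S. \<forall>i\<in>J - {j}. a i \<bullet> x < b' i) \<and>
     (\<forall>j\<in>T. \<exists>x\<in>S. a j \<bullet> x = b' j \<and> (\<forall>i\<in>J - {j}. a i \<bullet> x < b' i))"
proof -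
  have "finite T"
    using assms(2,3) finite_subset by blast
  then show ?thesis
    using assms(3)
  proof (induction T rule: finite_induct)
    case empty
    then show ?case
      using cover minimal by (intro exI[of _ b]) blast
  next
    case (insert j T)
    then obtain b' where cover': "\<And>x. x \<in> S \<Longrightarrow> \<exists>j\<in>J. b' j \<le> a j \<bullet> x"
      and minimal': "\<And>j. j \<in> J \<Longrightarrow> \<exists>x\<in>S. \<forall>i\<in>J - {j}. a i \<bullet> x < b' i"
      and tight: "\<And>j. j \<in> T \<Longrightarrow> \<exists>x\<in>S. a j \<bullet> x = b' j \<and> (\<forall>i\<in>J - {j}. a i \<bullet> x < b' i)"
      by (metis insert_subset)
    have j: "j \<in> J"
      using insert.prems by simp
    define X where "X = {x \<in> S. \<forall>i\<in>J - {j}. a i \<bullet> x < b' i}"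
    have X: "finite ((\<lambda>x. a j \<bullet> x) ` X)" "(\<lambda>x. a j \<bullet> x) ` X \<noteq> {}"
      using assms(1) minimal'[OF j] unfolding X_def by auto
    define c where "c = Min ((\<lambda>x. a j \<bullet> x) ` X)"
    obtain y where y: "y \<in> X" "a j \<bullet> y = c"
      using Min_in[OF X] unfolding c_def by auto
    have c_le: "c \<le> a j \<bullet> x" if "x \<in> X" for x
      unfolding c_def using X(1) that by (intro Min_le) auto
    have "b' j \<le> c"
      using cover'[of y] y unfolding X_def by (metis (no_types, lifting) DiffI empty_iff insert_iff mem_Collect_eq not_le)
    then have ge: "b' i \<le> (b'(j := c)) i" for i
      by simp
    show ?case
    proof (intro exI[of _ "b'(j := c)"] conjI ballI)
      fix x assume "x \<in> S"
      show "\<exists>i\<in>J. (b'(j := c)) i \<le> a i \<bullet> x"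
      proof (cases "x \<in> X")
        case True
        then show ?thesis using c_le j by (intro bexI[of _ j]) auto
      next
        case False
        then obtain i where "i \<in> J - {j}" "b' i \<le> a i \<bullet> x"
          using \<open>x \<in> S\<close> unfolding X_def by (auto simp: not_less)
        then show ?thesis by (intro bexI[of _ i]) auto
      qed
    next
      fix k assume "k \<in> J"
      then obtain x where "x \<in> S" "\<And>i. i \<in> J - {k} \<Longrightarrow> a i \<bullet> x < b' i"
        using minimal' by blast
      then have "\<forall>i\<in>J - {k}. a i \<bullet> x < (b'(j := c)) i"
        by (intro ballI order_less_le_trans[OF _ ge])
      then show "\<exists>x\<in>S. \<forall>i\<in>J - {k}. a i \<bullet> x < (b'(j := c)) i"
        using \<open>x \<in> S\<close> by (rule bexI)
    next
      fix k assume "k \<in> insert j T"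
      then consider "k = j" | "k \<in> T" "k \<noteq> j" by blast
      then show "\<exists>x\<in>S. a k \<bullet> x = (b'(j := c)) k \<and> (\<forall>i\<in>J - {k}. a i \<bullet> x < (b'(j := c)) i)"
      proof cases
        case 1
        then show ?thesis using y unfolding X_def by (intro bexI[of _ y]) auto
      next
        case 2
        then obtain x where x: "x \<in> S" "a k \<bullet> x = b' k" "\<And>i. i \<in> J - {k} \<Longrightarrow> a i \<bullet> x < b' i"
          using tight by blast
        show ?thesis
        proof (intro bexI[of _ x] conjI ballI)
          show "a k \<bullet> x = (b'(j := c)) k" using x(2) 2(2) by simp
          show "a i \<bullet> x < (b'(j := c)) i" if "i \<in> J - {k}" for i
            using order_less_le_trans[OF x(3)[OF that] ge] .
        qed (rule x(1))
      qed
    qed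
  qed
qed

text \<open>With more indices than classes, two tight witnesses \<open>x j\<close> and
  \<open>x k\<close> share a class, so their midpoint belongs to \<open>S\<close>. No index is
  exceeded at either witness and each is strict at one of them, so nothing cuts off the
  midpoint.\<close>

lemma card_irredundant_le_classes:
  fixes a :: "'j \<Rightarrow> 'a::real_inner" and c :: "'a \<Rightarrow> 'k"
  assumes "finite S" "finite J" "finite K"
    and cover: "\<And>x. x \<in> S \<Longrightarrow> \<exists>j\<in>J. b j \<le> a j \<bullet> x"
    and minimal: "\<And>j. j \<in> J \<Longrightarrow> \<exists>x\<in>S. \<forall>i\<in>J - {j}. a i \<bullet> x < b i"
    and c: "c ` S \<subseteq> K"
    and mid: "\<And>x y. x \<in> S \<Longrightarrow> y \<in> S \<Longrightarrow> c x = c y \<Longrightarrow> (1/2) *\<^sub>R (x + y) \<in> S"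
  shows "card J \<le> card K"
proof (rule ccontr)
  assume "\<not> card J \<le> card K"
  from tight_system[of S J J b a, OF assms(1,2) subset_refl cover minimal]
  obtain b' where "(\<forall>x\<in>S. \<exists>j\<in>J. b' j \<le> a j \<bullet> x) \<and>
     (\<forall>j\<in>J. \<exists>x\<in>S. \<forall>i\<in>J - {j}. a i \<bullet> x < b' i) \<and>
     (\<forall>j\<in>J. \<exists>x\<in>S. a j \<bullet> x = b' j \<and> (\<forall>i\<in>J - {j}. a i \<bullet> x < b' i))"
    by (rule exE)
  then have cover': "\<And>x. x \<in> S \<Longrightarrow> \<exists>j\<in>J. b' j \<le> a j \<bullet> x"
    and tight: "\<And>j. j \<in> J \<Longrightarrow> \<exists>x\<in>S. a j \<bullet> x = b' j \<and> (\<forall>i\<in>J - {j}. a i \<bullet> x < b' i)"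
    by simp_all
  have "\<forall>j\<in>J. \<exists>x. x \<in> S \<and> a j \<bullet> x = b' j \<and> (\<forall>i\<in>J - {j}. a i \<bullet> x < b' i)"
    using tight by blast
  then obtain x where x': "\<forall>j\<in>J. x j \<in> S \<and> a j \<bullet> x j = b' j \<and> (\<forall>i\<in>J - {j}. a i \<bullet> x j < b' i)"
    by (rule bchoice[THEN exE])
  then have x: "\<And>j. j \<in> J \<Longrightarrow> x j \<in> S" "\<And>j. j \<in> J \<Longrightarrow> a j \<bullet> x j = b' j"
    "\<And>i j. j \<in> J \<Longrightarrow> i \<in> J \<Longrightarrow> i \<noteq> j \<Longrightarrow> a i \<bullet> x j < b' i"
    by blast+
  have "(\<lambda>j. c (x j)) ` J \<subseteq> K"
    using c x(1) by blast
  then have "\<not> inj_on (\<lambda>j. c (x j)) J"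
    using \<open>\<not> card J \<le> card K\<close> assms(3) card_inj_on_le by blast
  then obtain j k where jk: "j \<in> J" "k \<in> J" "j \<noteq> k" "c (x j) = c (x k)"
    unfolding inj_on_def by blast
  then obtain i where i: "i \<in> J" "b' i \<le> a i \<bullet> ((1/2) *\<^sub>R (x j + x k))"
    using cover' mid x(1) by blast
  then have "2 * b' i \<le> a i \<bullet> x j + a i \<bullet> x k"
    by (simp add: inner_add_right)
  moreover have "a i \<bullet> x j \<le> b' i" "a i \<bullet> x k \<le> b' i"
    using x(2)[of i] x(3)[of j i] x(3)[of k i] i jk(1,2) by (cases "i = j"; cases "i = k"; force)+
  moreover have "a i \<bullet> x j < b' i \<or> a i \<bullet> x k < b' i"
    using x(3) i jk by blast
  ultimately show False
    by linarith
qed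

text \<open>Doignon's integer Helly theorem for open half-spaces. Finiteness of the sets \<open>S\<close> makes the
  minima in the tightening argument of \<open>tight_system\<close> exist, even for irrational normals.\<close>
lemma doignon_halfspaces:
  fixes a :: "'j \<Rightarrow> 'a::real_inner" and c :: "'a \<Rightarrow> 'k"
  assumes "finite J" "finite K"
    and cover: "\<And>x. x \<in> \<Lambda> \<Longrightarrow> \<exists>j\<in>J. b j \<le> a j \<bullet> x"
    and c: "c ` \<Lambda> \<subseteq> K"
    and mid: "\<And>X. finite X \<Longrightarrow> X \<subseteq> \<Lambda> \<Longrightarrow> \<exists>S. finite S \<and> X \<subseteq> S \<and> S \<subseteq> \<Lambda> \<and>
      (\<forall>x\<in>S. \<forall>y\<in>S. c x = c y \<longrightarrow> (1/2) *\<^sub>R (x + y) \<in> S)"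
  shows "\<exists>J'\<subseteq>J. card J' \<le> card K \<and> (\<forall>x\<in>\<Lambda>. \<exists>j\<in>J'. b j \<le> a j \<bullet> x)"
proof -
  define P where "P J' \<longleftrightarrow> J' \<subseteq> J \<and> (\<forall>x\<in>\<Lambda>. \<exists>j\<in>J'. b j \<le> a j \<bullet> x)" for J'
  have "P J"
    using cover by (simp add: P_def)
  then obtain J' where "P J'" and least: "\<And>J''. P J'' \<Longrightarrow> card J' \<le> card J''"
    using ex_has_least_nat[of P J card] by blast
  then have J': "J' \<subseteq> J" "\<And>x. x \<in> \<Lambda> \<Longrightarrow> \<exists>j\<in>J'. b j \<le> a j \<bullet> x"
    by (auto simp: P_def)
  have fin: "finite J'"
    using J'(1) assms(1) finite_subset by blast
  have "\<exists>x\<in>\<Lambda>. \<forall>i\<in>J' - {j}. a i \<bullet> x < b i" if "j \<in> J'" for j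
  proof -
    have "\<not> P (J' - {j})"
      using least[of "J' - {j}"] card_Diff1_less[OF fin that] by auto
    then show ?thesis
      using J'(1) unfolding P_def by (meson Diff_subset linorder_not_less subset_trans)
  qed
  then obtain x where x: "\<And>j. j \<in> J' \<Longrightarrow> x j \<in> \<Lambda>" "\<And>i j. j \<in> J' \<Longrightarrow> i \<in> J' - {j} \<Longrightarrow> a i \<bullet> x j < b i"
    by metis
  have "finite (x ` J')" "x ` J' \<subseteq> \<Lambda>"
    using fin x(1) by auto
  from mid[OF this] obtain S where "finite S \<and> x ` J' \<subseteq> S \<and> S \<subseteq> \<Lambda> \<and>
      (\<forall>x\<in>S. \<forall>y\<in>S. c x = c y \<longrightarrow> (1/2) *\<^sub>R (x + y) \<in> S)"
    by (rule exE)
  then have S: "finite S" "x ` J' \<subseteq> S" "S \<subseteq> \<Lambda>"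
    "\<And>x y. x \<in> S \<Longrightarrow> y \<in> S \<Longrightarrow> c x = c y \<Longrightarrow> (1/2) *\<^sub>R (x + y) \<in> S"
    by simp_all
  have "card J' \<le> card K"
  proof (rule card_irredundant_le_classes[OF S(1) fin assms(2)])
    show "\<exists>j\<in>J'. b j \<le> a j \<bullet> x" if "x \<in> S" for x
      using that J'(2) S(3) by blast
    show "\<exists>x\<in>S. \<forall>i\<in>J' - {j}. a i \<bullet> x < b i" if "j \<in> J'" for j
      using that S(2) x(2) by blast
    show "c ` S \<subseteq> K" using c S(3) by blast
  qed (use S(4) in blast)
  then show ?thesis
    using J' by blast
qed

lemma Ints_le_or_ge:
  fixes x :: real
  assumes "x \<in> \<int>"
  shows "x \<le> of_int p \<or> of_int (p + 1) \<le> x"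
proof -
  obtain m where m: "x = of_int m" using assms by (auto elim: Ints_cases)
  have "m \<le> p \<or> p + 1 \<le> m" by linarith
  then show ?thesis unfolding m of_int_le_iff .
qed

lemma finite_int_lattice_box: "finite {x \<in> int_lattice :: (real^'n) set. \<forall>i. \<bar>x $ i\<bar> \<le> M}"
proof -
  let ?F = "PiE (UNIV :: 'n set) (\<lambda>_. {- \<lceil>M\<rceil>..\<lceil>M\<rceil>})"
  have "{x \<in> int_lattice. \<forall>i. \<bar>x $ i\<bar> \<le> M} \<subseteq> (\<lambda>g. \<chi> i. real_of_int (g i)) ` ?F"
  proof
    fix x :: "real^'n"
    assume x: "x \<in> {x \<in> int_lattice. \<forall>i. \<bar>x $ i\<bar> \<le> M}"
    have "x $ i \<in> \<int>" for i
      using x unfolding int_lattice_def by simp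
    then have eq: "real_of_int \<lfloor>x $ i\<rfloor> = x $ i" for i
      by (metis Ints_cases floor_of_int)
    then have "x = (\<chi> i. real_of_int \<lfloor>x $ i\<rfloor>)"
      by (simp only: eq vec_lambda_eta)
    moreover have "(\<lambda>i. \<lfloor>x $ i\<rfloor>) \<in> ?F"
    proof -
      have "\<bar>real_of_int \<lfloor>x $ i\<rfloor>\<bar> \<le> real_of_int \<lceil>M\<rceil>" for i
        unfolding eq using x le_of_int_ceiling order_trans by blast
      then have "\<bar>\<lfloor>x $ i\<rfloor>\<bar> \<le> \<lceil>M\<rceil>" for i
        unfolding of_int_abs[symmetric] of_int_le_iff .
      then show ?thesis by (auto simp: abs_le_iff minus_le_iff)
    qed
    ultimately show "x \<in> (\<lambda>g. \<chi> i. real_of_int (g i)) ` ?F" by (rule image_eqI)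
  qed
  moreover have "finite ?F"
    by (intro finite_PiE) auto
  ultimately show ?thesis
    using finite_surj by blast
qed

lemma int_lattice_add: "x \<in> int_lattice \<Longrightarrow> y \<in> int_lattice \<Longrightarrow> x + y \<in> int_lattice"
  by (auto simp: int_lattice_def)

lemma int_lattice_inner: "x \<in> int_lattice \<Longrightarrow> y \<in> int_lattice \<Longrightarrow> x \<bullet> y \<in> \<int>"
  by (auto simp: int_lattice_def inner_vec_def)

definition lattice_layer :: "real^'n \<Rightarrow> int \<Rightarrow> (real^'n) set" where
  "lattice_layer u k = {x \<in> int_lattice. u \<bullet> x = of_int k}"

lemma half_Ints_sum:
  fixes x y :: real
  assumes "x \<in> \<int>" "y \<in> \<int>"
  shows "(x + y) / 2 \<in> \<int> \<longleftrightarrow> (odd \<lfloor>x\<rfloor> \<longleftrightarrow> odd \<lfloor>y\<rfloor>)"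
proof -
  obtain m n where mn: "x = of_int m" "y = of_int n"
    using assms by (auto elim!: Ints_cases)
  have "(x + y) / 2 \<in> \<int> \<longleftrightarrow> even (m + n)"
  proof
    assume "(x + y) / 2 \<in> \<int>"
    then obtain l where "(x + y) / 2 = of_int l" by (auto elim: Ints_cases)
    then have "real_of_int (m + n) = real_of_int (2 * l)" using mn by simp
    then have "m + n = 2 * l" by linarith
    then show "even (m + n)" by simp
  next
    assume "even (m + n)"
    then obtain l where "m + n = 2 * l" by (rule evenE)
    then have "x + y = 2 * of_int l" using mn by (metis of_int_add of_int_mult of_int_numeral)
    then show "(x + y) / 2 \<in> \<int>" by simp
  qed
  then show ?thesis using mn by auto
qed

text \<open>As \<open>u $ l\<close> is odd, the equation of the layer determines the parity of
  coordinate \<open>l\<close> from the other parities. Hence equal parities off \<open>l\<close> are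
  equal parities everywhere.\<close>

lemma layer_midpoint:
  fixes u :: "real^'n"
  assumes u: "u \<in> int_lattice" "odd \<lfloor>u $ l\<rfloor>"
    and xy: "x \<in> lattice_layer u k" "y \<in> lattice_layer u k"
    and parity: "{i. i \<noteq> l \<and> odd \<lfloor>x $ i\<rfloor>} = {i. i \<noteq> l \<and> odd \<lfloor>y $ i\<rfloor>}"
  shows "(1/2) *\<^sub>R (x + y) \<in> lattice_layer u k"
proof -
  define m where "m = (1/2) *\<^sub>R (x + y)"
  have int: "x $ i \<in> \<int>" "y $ i \<in> \<int>" "u $ i \<in> \<int>" for i
    using u xy unfolding lattice_layer_def int_lattice_def by auto
  have um: "u \<bullet> m = of_int k"
    using xy unfolding lattice_layer_def m_def by (simp add: inner_add_right)
  have m_int: "m $ i \<in> \<int>" if "i \<noteq> l" for i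
    using half_Ints_sum[OF int(1,2)[of i]] parity that unfolding m_def by auto
  have "u \<bullet> m = u $ l * m $ l + (\<Sum>i\<in>UNIV - {l}. u $ i * m $ i)"
    unfolding inner_vec_def by (simp add: sum.remove)
  then have "u $ l * m $ l = of_int k - (\<Sum>i\<in>UNIV - {l}. u $ i * m $ i)"
    using um by linarith
  also have "\<dots> \<in> \<int>"
    using m_int int by (intro Ints_diff Ints_sum Ints_mult) auto
  finally have ul: "u $ l * m $ l \<in> \<int>" .
  obtain p where p: "u $ l = of_int p" "odd p"
    using int(3)[of l] u(2) by (auto elim!: Ints_cases)
  then obtain q where q: "p = 2 * q + 1" by (auto elim: oddE)
  have "u $ l * m $ l = of_int q * (x $ l + y $ l) + m $ l"
    unfolding p(1) q m_def by (simp add: algebra_simps)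
  then have "m $ l = u $ l * m $ l - of_int q * (x $ l + y $ l)"
    by linarith
  also have "\<dots> \<in> \<int>"
    by (intro Ints_diff Ints_mult Ints_add ul int Ints_of_int)
  finally have "m $ l \<in> \<int>" .
  then have "m $ i \<in> \<int>" for i
    using m_int by (cases "i = l") auto
  then show ?thesis
    using um unfolding lattice_layer_def int_lattice_def m_def by blast
qed

text \<open>The layer meets only half of the \<open>2 ^ n\<close> parity classes.\<close>
lemma doignon_layer:
  fixes u :: "real^'n" and a :: "'j \<Rightarrow> real^'n"
  assumes u: "u \<in> int_lattice" "odd \<lfloor>u $ l\<rfloor>" and "finite J"
    and cover: "\<And>x. x \<in> lattice_layer u k \<Longrightarrow> \<exists>j\<in>J. b j \<le> a j \<bullet> x"
  shows "\<exists>J'\<subseteq>J. card J' \<le> 2 ^ (CARD('n) - 1) \<and> (\<forall>x\<in>lattice_layer u k. \<exists>j\<in>J'. b j \<le> a j \<bullet> x)"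
proof -
  let ?c = "\<lambda>x :: real^'n. {i. i \<noteq> l \<and> odd \<lfloor>x $ i\<rfloor>}"
  let ?K = "Pow (UNIV - {l})"
  have "card ?K = 2 ^ (CARD('n) - 1)"
    by (simp add: card_Pow card_Diff_singleton)
  moreover have "\<exists>J'\<subseteq>J. card J' \<le> card ?K \<and> (\<forall>x\<in>lattice_layer u k. \<exists>j\<in>J'. b j \<le> a j \<bullet> x)"
  proof (rule doignon_halfspaces[where c = ?c])
    fix X assume X: "finite X" "X \<subseteq> lattice_layer u k"
    define M where "M = (\<Sum>x\<in>X. \<Sum>i\<in>UNIV. \<bar>x $ i\<bar>)"
    \<comment> \<open>A box in the layer: integrality makes it finite, convexity keeps midpoints
      inside.\<close>
    define S where "S = {x \<in> lattice_layer u k. \<forall>i. \<bar>x $ i\<bar> \<le> M}"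
    have "finite S"
      by (rule finite_subset[OF _ finite_int_lattice_box[of M]]) (auto simp: S_def lattice_layer_def)
    moreover have "X \<subseteq> S"
    proof
      fix x assume "x \<in> X"
      have "\<bar>x $ i\<bar> \<le> M" for i
      proof -
        have "\<bar>x $ i\<bar> \<le> (\<Sum>i\<in>UNIV. \<bar>x $ i\<bar>)"
          by (rule member_le_sum) auto
        also have "\<dots> \<le> M"
          unfolding M_def using \<open>x \<in> X\<close> X(1)
          by (intro member_le_sum[of x X "\<lambda>x. \<Sum>i\<in>UNIV. \<bar>x $ i\<bar>"]) (auto intro: sum_nonneg)
        finally show ?thesis .
      qed
      then show "x \<in> S" using \<open>x \<in> X\<close> X(2) unfolding S_def by blast
    qed
    moreover have "(1/2) *\<^sub>R (x + y) \<in> S" if "x \<in> S" "y \<in> S" "?c x = ?c y" for x y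
    proof -
      have "\<bar>((1/2) *\<^sub>R (x + y)) $ i\<bar> \<le> M" for i
      proof -
        have "\<bar>x $ i\<bar> \<le> M" "\<bar>y $ i\<bar> \<le> M" using that(1,2) unfolding S_def by auto
        then show ?thesis by simp
      qed
      then show ?thesis
        using that layer_midpoint[OF u] unfolding S_def by blast
    qed
    ultimately show "\<exists>S. finite S \<and> X \<subseteq> S \<and> S \<subseteq> lattice_layer u k \<and>
        (\<forall>x\<in>S. \<forall>y\<in>S. ?c x = ?c y \<longrightarrow> (1/2) *\<^sub>R (x + y) \<in> S)"
      by (intro exI[of _ S]) (auto simp: S_def)
  qed (use assms(3) cover in auto)
  ultimately show ?thesis
    by simp
qed

text \<open>The vectors \<open>w i\<close> are integral and orthogonal to \<open>u\<close>, and each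
  \<open>y\<close> orthogonal to \<open>u\<close> is their combination with coefficients
  \<open>y $ i / u $ l\<close>. Rounding these down costs at most the sum of the norms of the
  \<open>w i\<close>, independently of \<open>y\<close>.\<close>

lemma lattice_near_orthogonal_vector:
  fixes u :: "real^'n"
  assumes u: "u \<in> int_lattice" "u $ l \<noteq> 0"
  obtains C where "\<And>y. u \<bullet> y = 0 \<Longrightarrow> \<exists>z\<in>lattice_layer u 0. norm (z - y) \<le> C"
proof
  define w where "w i = (u $ l) *\<^sub>R axis i 1 - (u $ i) *\<^sub>R axis l (1::real)" for i
  fix y :: "real^'n" assume y: "u \<bullet> y = 0"
  define z where "z = (\<Sum>i\<in>UNIV. of_int \<lfloor>y $ i / u $ l\<rfloor> *\<^sub>R w i)"
  have w_nth: "w i $ j = u $ l * (if i = j then 1 else 0) - u $ i * (if l = j then 1 else 0)" for i j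
    by (simp add: w_def axis_def)
  have y_eq: "y = (\<Sum>i\<in>UNIV. (y $ i / u $ l) *\<^sub>R w i)"
  proof (rule vec_eq_iff[THEN iffD2], rule allI)
    fix j
    have "(\<Sum>i\<in>UNIV. (y $ i / u $ l) *\<^sub>R w i) $ j
        = (\<Sum>i\<in>UNIV. (if i = j then y $ i else 0) - y $ i * u $ i * ((if l = j then 1 else 0) / u $ l))"
      unfolding sum_component vector_scaleR_component w_nth using u(2)
      by (intro sum.cong) (auto simp: field_simps)
    also have "\<dots> = y $ j - (\<Sum>i\<in>UNIV. y $ i * u $ i) * ((if l = j then 1 else 0) / u $ l)"
      unfolding sum_subtractf sum_distrib_right by simp
    also have "(\<Sum>i\<in>UNIV. y $ i * u $ i) = 0"
      using y by (simp add: inner_vec_def mult.commute)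
    finally show "y $ j = (\<Sum>i\<in>UNIV. (y $ i / u $ l) *\<^sub>R w i) $ j"
      by simp
  qed
  have uw: "u \<bullet> w i = 0" for i
    unfolding w_def by (simp add: inner_diff_right inner_axis mult.commute)
  have "u \<bullet> z = 0"
    unfolding z_def by (simp add: inner_sum_right uw)
  moreover have "z \<in> int_lattice"
    using u(1) unfolding int_lattice_def z_def
    by (auto simp: w_nth intro!: Ints_sum Ints_mult Ints_diff)
  ultimately have "z \<in> lattice_layer u 0"
    unfolding lattice_layer_def by simp
  moreover have "norm (z - y) \<le> (\<Sum>i\<in>UNIV. norm (w i))"
  proof -
    have "z - y = (\<Sum>i\<in>UNIV. (of_int \<lfloor>y $ i / u $ l\<rfloor> - y $ i / u $ l) *\<^sub>R w i)"
      using y_eq unfolding z_def by (simp add: sum_subtractf scaleR_diff_left)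
    also have "norm \<dots> \<le> (\<Sum>i\<in>UNIV. norm (w i))"
    proof (rule sum_norm_le)
      fix i
      have "\<bar>of_int \<lfloor>y $ i / u $ l\<rfloor> - y $ i / u $ l\<bar> \<le> 1" by linarith
      then show "norm ((of_int \<lfloor>y $ i / u $ l\<rfloor> - y $ i / u $ l) *\<^sub>R w i) \<le> norm (w i)"
        by (simp add: mult_left_le_one_le)
    qed
    finally show ?thesis .
  qed
  ultimately show "\<exists>z\<in>lattice_layer u 0. norm (z - y) \<le> (\<Sum>i\<in>UNIV. norm (w i))"
    by blast
qed

text \<open>Since \<open>a\<close> need not be injective, the weight of a vector \<open>v\<close> is
  shared equally among the \<open>m v\<close> indices that produce it.\<close>

lemma convex_hull_image_coeffs:
  assumes "finite J" "y \<in> convex hull (a ` J)"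
  obtains c where "\<And>j. j \<in> J \<Longrightarrow> 0 \<le> c j" "sum c J = 1" "(\<Sum>j\<in>J. c j *\<^sub>R a j) = y"
proof -
  obtain w where w: "\<And>v. v \<in> a ` J \<Longrightarrow> 0 \<le> w v" "sum w (a ` J) = 1" "(\<Sum>v\<in>a ` J. w v *\<^sub>R v) = y"
    using assms by (auto simp: convex_hull_finite)
  define m where "m v = card {i \<in> J. a i = v}" for v
  have m: "m v > 0" if "v \<in> a ` J" for v
    using that assms(1) unfolding m_def by (auto simp: card_gt_0_iff)
  define c where "c j = w (a j) / m (a j)" for j
  have "sum c J = (\<Sum>v\<in>a ` J. sum c {j \<in> J. a j = v})"
    by (rule sum.image_gen[OF assms(1)])
  also have "\<dots> = sum w (a ` J)"
  proof (rule sum.cong[OF refl])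
    fix v assume v: "v \<in> a ` J"
    have "sum c {j \<in> J. a j = v} = (\<Sum>j\<in>{j \<in> J. a j = v}. w v / m v)"
      by (rule sum.cong) (auto simp: c_def)
    also have "\<dots> = w v" using m[OF v] unfolding m_def by simp
    finally show "sum c {j \<in> J. a j = v} = w v" .
  qed
  finally have 1: "sum c J = 1" using w(2) by simp
  have "(\<Sum>j\<in>J. c j *\<^sub>R a j) = (\<Sum>v\<in>a ` J. \<Sum>j\<in>{j \<in> J. a j = v}. c j *\<^sub>R a j)"
    by (rule sum.image_gen[OF assms(1)])
  also have "\<dots> = (\<Sum>v\<in>a ` J. w v *\<^sub>R v)"
  proof (rule sum.cong[OF refl])
    fix v assume v: "v \<in> a ` J"
    have "(\<Sum>j\<in>{j \<in> J. a j = v}. c j *\<^sub>R a j) = (\<Sum>j\<in>{j \<in> J. a j = v}. (w v / m v) *\<^sub>R v)"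
      by (rule sum.cong) (auto simp: c_def)
    also have "\<dots> = w v *\<^sub>R v"
      using m[OF v] unfolding m_def by (simp add: scaleR_left.sum[symmetric])
    finally show "(\<Sum>j\<in>{j \<in> J. a j = v}. c j *\<^sub>R a j) = w v *\<^sub>R v" .
  qed
  finally have "(\<Sum>j\<in>J. c j *\<^sub>R a j) = y" using w(3) by simp
  moreover have "0 \<le> c j" if "j \<in> J" for j
    unfolding c_def using w(1) that by simp
  ultimately show thesis using that 1 by blast
qed

text \<open>Otherwise the system would be satisfied along a whole open cone of directions orthogonal to
  \<open>u\<close>, hence by a point of the layer.\<close>
lemma layer_cover_multipliers:
  fixes u :: "real^'n" and a :: "'j \<Rightarrow> real^'n"
  assumes u: "u \<in> int_lattice" "u $ l \<noteq> 0" and J: "finite J"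
    and cover: "\<And>x. x \<in> lattice_layer u k \<Longrightarrow> \<exists>j\<in>J. b j \<le> a j \<bullet> x"
    and ne: "lattice_layer u k \<noteq> {}"
  obtains c \<mu> where "\<And>j. j \<in> J \<Longrightarrow> 0 \<le> c j" "sum c J = 1" "(\<Sum>j\<in>J. c j *\<^sub>R a j) = \<mu> *\<^sub>R u"
proof (cases "convex hull (a ` J) \<inter> range (\<lambda>t. t *\<^sub>R u) = {}")
  case False
  then obtain \<mu> where "\<mu> *\<^sub>R u \<in> convex hull (a ` J)" by auto
  then show thesis
    by (rule convex_hull_image_coeffs[OF J]) (rule that)
next
  case True
  have span: "range (\<lambda>t. t *\<^sub>R u) = span {u}"
    by (auto simp: span_singleton)
  obtain x0 where x0: "x0 \<in> lattice_layer u k" using ne by blast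
  then have "J \<noteq> {}" using cover by blast
  have "convex (range (\<lambda>t. t *\<^sub>R u))" "closed (range (\<lambda>t. t *\<^sub>R u))"
    unfolding span by (auto simp: closed_span intro: subspace_imp_convex)
  moreover have "compact (convex hull (a ` J))" "convex hull (a ` J) \<noteq> {}"
    using J \<open>J \<noteq> {}\<close> by (auto simp: finite_imp_compact_convex_hull)
  ultimately obtain y \<beta> where y: "\<forall>v\<in>convex hull (a ` J). y \<bullet> v < \<beta>"
    "\<forall>v\<in>range (\<lambda>t. t *\<^sub>R u). \<beta> < y \<bullet> v"
    using separating_hyperplane_compact_closed[OF convex_convex_hull _ _ _ _ True] by metis
  have yt: "\<beta> < t * (y \<bullet> u)" for t
    using y(2) by simp
  have \<beta>: "\<beta> < 0" using yt[of 0] by simp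
  \<comment> \<open>A linear functional bounded below on the line spanned by \<open>u\<close>
    vanishes there.\<close>
  have yu: "u \<bullet> y = 0"
  proof (rule ccontr)
    assume "u \<bullet> y \<noteq> 0"
    then show False using yt[of "\<beta> / (u \<bullet> y)"] by (simp add: inner_commute)
  qed
  have ay: "a j \<bullet> y < \<beta>" if "j \<in> J" for j
    using bspec[OF y(1) hull_inc[of "a j"]] that by (simp add: inner_commute)
  obtain C where C: "\<And>y. u \<bullet> y = 0 \<Longrightarrow> \<exists>z\<in>lattice_layer u 0. norm (z - y) \<le> C"
    using lattice_near_orthogonal_vector[OF u] by blast
  \<comment> \<open>So far along \<open>y\<close> that the decrease \<open>N * \<beta>\<close>
    outweighs, for every \<open>j\<close>, the excess at \<open>x0\<close> and the error of rounding
    to the lattice. Then no \<open>j\<close> cuts off \<open>x0 + z\<close>.\<close>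
  define N where "N = (1 + (\<Sum>j\<in>J. \<bar>a j \<bullet> x0 - b j\<bar> + norm (a j) * \<bar>C\<bar>)) / (- \<beta>)"
  obtain z where z: "z \<in> lattice_layer u 0" "norm (z - N *\<^sub>R y) \<le> C"
    using C[of "N *\<^sub>R y"] yu by auto
  have "x0 + z \<in> lattice_layer u k"
    using x0 z(1) unfolding lattice_layer_def by (auto simp: int_lattice_add inner_add_right)
  then obtain j where j: "j \<in> J" "b j \<le> a j \<bullet> (x0 + z)"
    using cover by blast
  have N0: "N \<ge> 0"
    unfolding N_def using \<beta> by (intro divide_nonneg_nonneg add_nonneg_nonneg sum_nonneg) auto
  have "a j \<bullet> (z - N *\<^sub>R y) \<le> norm (a j) * norm (z - N *\<^sub>R y)"
    by (rule norm_cauchy_schwarz)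
  also have "\<dots> \<le> norm (a j) * \<bar>C\<bar>"
    using z(2) by (intro mult_left_mono) auto
  finally have "a j \<bullet> z \<le> N * (a j \<bullet> y) + norm (a j) * \<bar>C\<bar>"
    by (simp add: inner_diff_right)
  moreover have "N * (a j \<bullet> y) \<le> N * \<beta>"
    using ay[OF j(1)] N0 by (intro mult_left_mono) auto
  moreover have "N * \<beta> = - (1 + (\<Sum>j\<in>J. \<bar>a j \<bullet> x0 - b j\<bar> + norm (a j) * \<bar>C\<bar>))"
    unfolding N_def using \<beta> by simp
  moreover have "\<bar>a j \<bullet> x0 - b j\<bar> + norm (a j) * \<bar>C\<bar> \<le> (\<Sum>j\<in>J. \<bar>a j \<bullet> x0 - b j\<bar> + norm (a j) * \<bar>C\<bar>)"
    using J j(1) by (intro member_le_sum[of j J "\<lambda>j. \<bar>a j \<bullet> x0 - b j\<bar> + norm (a j) * \<bar>C\<bar>"]) auto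
  moreover have "b j \<le> a j \<bullet> x0 + a j \<bullet> z"
    using j(2) by (simp add: inner_add_right)
  ultimately have False
    by linarith
  then show thesis ..
qed

subsection \<open>The upper bound\<close>

text \<open>Settles the cases in which no half-space of \<open>B\<close> has to be tilted; two
  facets never exceed the allowed \<open>2 ^ (CARD('n) - 1) + 1\<close>.\<close>

lemma slab_Lfree_poly:
  fixes u f :: "real^'n" and k p q :: int
  assumes u: "u \<in> int_lattice" and f: "p < u \<bullet> f - k" "u \<bullet> f - k < q"
    and free: "\<And>z. z \<in> int_lattice \<Longrightarrow> u \<bullet> z - k \<le> p \<or> u \<bullet> z - k \<ge> q"
  shows "{x. p \<le> u \<bullet> x - k \<and> u \<bullet> x - k \<le> q} \<in> Lfree_poly 2"
proof -
  define a where "a j = (if j then u else - u)" for j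
  define b where "b j = (if j then real_of_int (q + k) else - (p + k))" for j
  have "{x. \<forall>j\<in>UNIV. a j \<bullet> x \<le> b j} \<in> Lfree_poly 2"
  proof (rule Lfree_poly_halfspaces[of _ _ _ f])
    show "a j \<bullet> f < b j" for j
      using f by (simp add: a_def b_def)
    show "\<exists>j\<in>UNIV. b j \<le> a j \<bullet> z" if "z \<in> int_lattice" for z
    proof -
      have "b True \<le> a True \<bullet> z \<or> b False \<le> a False \<bullet> z"
        using free[OF that] unfolding a_def b_def by auto
      then show ?thesis by blast
    qed
  qed auto
  moreover have "{x. \<forall>j\<in>UNIV. a j \<bullet> x \<le> b j} = {x. p \<le> u \<bullet> x - k \<and> u \<bullet> x - k \<le> q}"
    by (auto simp: a_def b_def UNIV_bool)
  ultimately show ?thesis by simp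
qed

lemma Lfree_poly_mono: "i \<le> i' \<Longrightarrow> B \<in> Lfree_poly i \<Longrightarrow> B \<in> Lfree_poly i'"
  by (auto simp: Lfree_poly_def)

text \<open>The half-spaces of \<open>B\<close> that already cut off the layer \<open>u \<bullet> x = k\<close> are rotated around their
  traces in it until they touch the shrunken copy of \<open>B\<close>; they then bound a cone that lies above
  the layer \<open>k - 1\<close>.\<close>
lemma truncated_cone:
  fixes u f :: "real^'n" and a :: "'j \<Rightarrow> real^'n" and k :: int
  assumes u: "u \<in> int_lattice" "odd \<lfloor>u $ l\<rfloor>"
    and J: "finite J" and B: "B = {x. \<forall>j\<in>J. a j \<bullet> x \<le> b j}"
    and free: "\<And>z. z \<in> int_lattice \<Longrightarrow> \<exists>j\<in>J. b j \<le> a j \<bullet> z"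
    and f: "\<And>j. j \<in> J \<Longrightarrow> a j \<bullet> f < b j"
    and ne: "lattice_layer u k \<noteq> {}"
    and t: "t = u \<bullet> f - k" "t < 1"
    and H: "\<And>x. x \<in> B \<Longrightarrow> u \<bullet> x - k \<le> H" "\<And>y. (\<And>x. x \<in> B \<Longrightarrow> u \<bullet> x - k \<le> y) \<Longrightarrow> H \<le> y"
    and G: "\<And>x. x \<in> B \<Longrightarrow> - G \<le> u \<bullet> x - k" "\<And>y. (\<And>x. x \<in> B \<Longrightarrow> y \<le> u \<bullet> x - k) \<Longrightarrow> y \<le> - G"
    and pos: "G > 0" "H > 0" "0 < \<beta>" "\<beta> < 1"
    and top: "\<beta> * H + (1 - \<beta>) * t \<le> 1"
    and bot: "\<beta> * G - (1 - \<beta>) * t > 0"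
    and ineq: "\<beta> * G * (1 + 1 / H) \<le> (1 - \<beta>) * (1 + t)"
  shows "\<exists>L\<in>Lfree_poly (2 ^ (CARD('n) - 1) + 1). \<forall>x\<in>B. f + \<beta> *\<^sub>R (x - f) \<in> L"
proof -
  have "\<exists>J'\<subseteq>J. card J' \<le> 2 ^ (CARD('n) - 1) \<and> (\<forall>x\<in>lattice_layer u k. \<exists>j\<in>J'. b j \<le> a j \<bullet> x)"
    using free by (intro doignon_layer[OF u J]) (simp add: lattice_layer_def)
  then obtain J' where J': "J' \<subseteq> J" "card J' \<le> 2 ^ (CARD('n) - 1)"
    and cover: "\<And>x. x \<in> lattice_layer u k \<Longrightarrow> \<exists>j\<in>J'. b j \<le> a j \<bullet> x"
    by auto
  have finJ': "finite J'"
    using J' J finite_subset by blast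
  have "u $ l \<noteq> 0" using u(2) by auto
  from layer_cover_multipliers[OF u(1) this finJ' cover ne]
  obtain c \<mu> where c: "\<And>j. j \<in> J' \<Longrightarrow> 0 \<le> c j" "sum c J' = 1" "(\<Sum>j\<in>J'. c j *\<^sub>R a j) = \<mu> *\<^sub>R u"
    by blast
  \<comment> \<open>The shrunken copy has height at least \<open>- g\<close> relative to the layer,
    and each half-space has slack at least \<open>(1 - \<beta>) * \<sigma> j\<close> on it. The tilt
    \<open>s j = (1 - \<beta>) * \<sigma> j / g\<close> is the steepest for which this slack keeps
    the copy inside.\<close>
  define g where "g = \<beta> * G - (1 - \<beta>) * t"
  have g: "g > 0" using bot by (simp add: g_def)
  define d where "d = (1 - \<beta>) / g"
  have d: "d > 0" "d * g = 1 - \<beta>" using g pos by (simp_all add: d_def)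
  define \<sigma> where "\<sigma> j = b j - a j \<bullet> f" for j
  have \<sigma>: "\<sigma> j > 0" if "j \<in> J" for j using f[OF that] by (simp add: \<sigma>_def)
  define s where "s j = d * \<sigma> j" for j
  \<comment> \<open>The multipliers combine the half-spaces into
    \<open>0 \<le> K - \<mu> * (u \<bullet> x - k)\<close>, valid on all of
    \<open>B\<close>.\<close>
  define K where "K = (\<Sum>j\<in>J'. c j * b j) - \<mu> * k"
  have csum: "(\<Sum>j\<in>J'. c j * (b j - a j \<bullet> x)) = K - \<mu> * (u \<bullet> x - k)" for x
  proof -
    have "(\<Sum>j\<in>J'. c j * (a j \<bullet> x)) = (\<Sum>j\<in>J'. c j *\<^sub>R a j) \<bullet> x"
      by (simp add: inner_sum_left)
    then show ?thesis
      unfolding c(3) K_def by (simp add: algebra_simps sum_subtractf)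
  qed
  have B_nonneg: "0 \<le> K - \<mu> * (u \<bullet> x - k)" if "x \<in> B" for x
  proof -
    have "0 \<le> (\<Sum>j\<in>J'. c j * (b j - a j \<bullet> x))"
      using that c(1) J'(1) unfolding B by (intro sum_nonneg mult_nonneg_nonneg) auto
    then show ?thesis using csum by simp
  qed
  have fB: "f \<in> B" unfolding B using f by (auto intro: less_imp_le)
  \<comment> \<open>The combined inequality passes to the extreme heights \<open>H\<close> and
    \<open>- G\<close> even if \<open>B\<close> does not attain them; the sign of \<mu> decides at
    which end the limit is needed.\<close>
  have KH: "0 \<le> K - \<mu> * H"
  proof (cases "\<mu> \<le> 0")
    case True
    then have "\<mu> * H \<le> \<mu> * (u \<bullet> f - k)" using H(1)[OF fB] by (simp add: mult_left_mono_neg)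
    then show ?thesis using B_nonneg[OF fB] by linarith
  next
    case False
    have "H \<le> K / \<mu>"
      using B_nonneg False by (intro H(2)) (simp add: pos_le_divide_eq mult.commute)
    then show ?thesis using False by (simp add: pos_le_divide_eq mult.commute)
  qed
  have KG: "0 \<le> K + \<mu> * G"
  proof (cases "\<mu> \<ge> 0")
    case True
    then have "\<mu> * (- G) \<le> \<mu> * (u \<bullet> f - k)" using G(1)[OF fB] by (intro mult_left_mono) auto
    then show ?thesis using B_nonneg[OF fB] by simp
  next
    case False
    have "K / \<mu> \<le> - G"
      using B_nonneg False by (intro G(2)) (simp add: neg_divide_le_eq mult.commute)
    then show ?thesis using False by (simp add: neg_divide_le_eq mult.commute)
  qed
  \<comment> \<open>The layer lies between the extreme heights, so \<open>K\<close> is the mean of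
    the two values there with weights \<open>G\<close> and \<open>H\<close>.\<close>
  have K: "K \<ge> 0"
  proof -
    have "0 \<le> G * (K - \<mu> * H)" "0 \<le> H * (K + \<mu> * G)"
      using mult_nonneg_nonneg[OF _ KH, of G] mult_nonneg_nonneg[OF _ KG, of H] pos by simp_all
    then have "0 \<le> G * (K - \<mu> * H) + H * (K + \<mu> * G)"
      by (rule add_nonneg_nonneg)
    also have "\<dots> = (G + H) * K" by (simp add: algebra_simps)
    finally show ?thesis using pos by (simp add: zero_le_mult_iff)
  qed
  \<comment> \<open>After tilting, the combination at height \<open>h\<close> reads
    \<open>0 \<le> K + h * Q\<close>. With \<open>0 \<le> K \<le> Q\<close> its strict form fails
    for every \<open>h \<le> -1\<close>, which removes all layers below \<open>k\<close>. By
    \<open>\<mu> \<le> K / H\<close> the claim reduces to the assumption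
    \<open>ineq\<close>.\<close>
  define Q where "Q = d * (K - \<mu> * t) - \<mu>"
  have Q: "K \<le> Q"
  proof -
    have "\<mu> \<le> K / H" using KH pos by (simp add: pos_le_divide_eq)
    then have "\<mu> * (\<beta> * G) \<le> K / H * (\<beta> * G)" using pos by (intro mult_right_mono) auto
    moreover have "K * (\<beta> * G * (1 + 1 / H)) \<le> K * ((1 - \<beta>) * (1 + t))"
      using ineq K by (rule mult_left_mono)
    moreover have "g * (Q - K) = (d * g) * (K - \<mu> * t) - \<mu> * g - K * g"
      unfolding Q_def by (simp add: algebra_simps)
    moreover have "\<dots> = K * ((1 - \<beta>) * (1 + t)) - K * (\<beta> * G * (1 + 1 / H)) + (K / H * (\<beta> * G) - \<mu> * (\<beta> * G))"
      unfolding d(2) unfolding g_def by (simp add: algebra_simps divide_inverse)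
    ultimately have "0 \<le> g * (Q - K)" by linarith
    then show ?thesis using g by (simp add: zero_le_mult_iff)
  qed
  \<comment> \<open>\<open>None\<close> stands for the truncation at the next layer,
    \<open>Some j\<close> for the tilted half-space, whose trace at height 0 is unchanged.\<close>
  define a' where "a' = case_option u (\<lambda>j. a j - s j *\<^sub>R u)"
  define b' where "b' = case_option (1 + real_of_int k) (\<lambda>j. b j - s j * k)"
  define I where "I = insert None (Some ` J')"
  have a'_le: "a' (Some j) \<bullet> x \<le> b' (Some j) \<longleftrightarrow> a j \<bullet> x \<le> b j + s j * (u \<bullet> x - k)"
    "a' (Some j) \<bullet> x < b' (Some j) \<longleftrightarrow> a j \<bullet> x < b j + s j * (u \<bullet> x - k)" for j x
    by (auto simp: a'_def b'_def algebra_simps)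
  let ?L = "{x. \<forall>j\<in>I. a' j \<bullet> x \<le> b' j}"
  have "?L \<in> Lfree_poly (2 ^ (CARD('n) - 1) + 1)"
  proof (rule Lfree_poly_halfspaces[of _ _ _ f])
    show "finite I" unfolding I_def using finJ' by simp
    show "card I \<le> 2 ^ (CARD('n) - 1) + 1"
      unfolding I_def using finJ' J'(2) by (simp add: card_insert_if card_image)
    show "a' j \<bullet> f < b' j" if "j \<in> I" for j
    proof (cases j)
      case None
      then show ?thesis using t by (simp add: a'_def b'_def)
    next
      case (Some i)
      then have i: "i \<in> J" using that J'(1) unfolding I_def by auto
      have "g * (1 + d * t) = g + (d * g) * t" by (simp add: algebra_simps)
      also have "\<dots> = \<beta> * G" unfolding d(2) unfolding g_def by (simp add: algebra_simps)
      finally have "0 < 1 + d * t" using g pos by (metis mult_pos_pos zero_less_mult_pos)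
      then have "0 < \<sigma> i * (1 + d * t)" using \<sigma>[OF i] by simp
      then have "a i \<bullet> f < b i + s i * (u \<bullet> f - k)"
        unfolding t(1)[symmetric] s_def \<sigma>_def by (simp add: algebra_simps)
      then show ?thesis unfolding Some a'_le .
    qed
    show "\<exists>j\<in>I. b' j \<le> a' j \<bullet> z" if z: "z \<in> int_lattice" for z
    proof (rule ccontr)
      assume "\<not> (\<exists>j\<in>I. b' j \<le> a' j \<bullet> z)"
      then have lt: "\<And>j. j \<in> I \<Longrightarrow> a' j \<bullet> z < b' j" by (auto simp: not_le)
      have "u \<bullet> z \<in> \<int>" using int_lattice_inner u(1) z by blast
      then obtain m where m: "u \<bullet> z = of_int m" by (auto elim: Ints_cases)
      have lt': "a j \<bullet> z < b j + s j * (u \<bullet> z - k)" if "j \<in> J'" for j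
        using lt[of "Some j"] that a'_le(2) unfolding I_def by blast
      have "m < 1 + k" using lt[of None] m unfolding I_def a'_def b'_def by simp
      moreover have "m \<noteq> k"
      proof
        assume "m = k"
        then have "z \<in> lattice_layer u k" using z m unfolding lattice_layer_def by simp
        then obtain j where "j \<in> J'" "b j \<le> a j \<bullet> z" using cover by blast
        then show False using lt'[of j] m \<open>m = k\<close> by simp
      qed
      ultimately have mk: "real_of_int (m - k) \<le> -1" by linarith
      have "0 < (\<Sum>j\<in>J'. c j * (b j + s j * (m - k) - a j \<bullet> z))"
      proof -
        obtain j where j: "j \<in> J'" "c j \<noteq> 0"
          using c(2) by (metis sum.neutral zero_neq_one)
        show ?thesis
        proof (rule sum_pos2[OF finJ' j(1)])
          show "0 < c j * (b j + s j * (m - k) - a j \<bullet> z)"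
            using lt'[OF j(1)] m c(1)[OF j(1)] j(2) by (intro mult_pos_pos) auto
          show "0 \<le> c i * (b i + s i * (m - k) - a i \<bullet> z)" if "i \<in> J'" for i
            using lt'[OF that] m c(1)[OF that] by (intro mult_nonneg_nonneg) auto
        qed
      qed
      also have "(\<Sum>j\<in>J'. c j * (b j + s j * (m - k) - a j \<bullet> z))
          = (\<Sum>j\<in>J'. c j * (b j - a j \<bullet> z)) + (m - k) * d * (\<Sum>j\<in>J'. c j * (b j - a j \<bullet> f))"
        unfolding s_def \<sigma>_def by (simp add: sum_distrib_left sum.distrib[symmetric] algebra_simps)
      also have "\<dots> = K + (m - k) * Q"
        unfolding csum m t(1)[symmetric] Q_def by (simp add: algebra_simps)
      also have "\<dots> \<le> K + (-1) * Q"
        using mk K Q by (intro add_left_mono mult_right_mono) auto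
      also have "\<dots> \<le> 0" using Q by simp
      finally show False by simp
    qed
  qed
  moreover have "f + \<beta> *\<^sub>R (x - f) \<in> ?L" if x: "x \<in> B" for x
  proof -
    let ?y = "f + \<beta> *\<^sub>R (x - f)"
    have hy: "u \<bullet> ?y - k = \<beta> * (u \<bullet> x - k) + (1 - \<beta>) * t"
      unfolding t(1) by (simp add: algebra_simps)
    have "a' j \<bullet> ?y \<le> b' j" if "j \<in> I" for j
    proof (cases j)
      case None
      have "\<beta> * (u \<bullet> x - k) \<le> \<beta> * H" using H(1)[OF x] pos by (intro mult_left_mono) auto
      then have "u \<bullet> ?y - k \<le> 1" unfolding hy using top by linarith
      then show ?thesis using None by (simp add: a'_def b'_def)
    next
      case (Some i)
      then have i: "i \<in> J" using that J'(1) unfolding I_def by auto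
      have "\<beta> * (- G) \<le> \<beta> * (u \<bullet> x - k)" using G(1)[OF x] pos by (intro mult_left_mono) auto
      then have "- g \<le> u \<bullet> ?y - k" unfolding hy g_def by simp
      then have "d * (- g) \<le> d * (u \<bullet> ?y - k)" using d(1) by (intro mult_left_mono) auto
      then have "0 \<le> 1 - \<beta> + d * (u \<bullet> ?y - k)" using d(2) by simp
      then have "0 \<le> \<sigma> i * (1 - \<beta> + d * (u \<bullet> ?y - k))" using \<sigma>[OF i] by simp
      moreover have "a i \<bullet> ?y = \<beta> * (a i \<bullet> x) + (1 - \<beta>) * (a i \<bullet> f)" by (simp add: algebra_simps)
      moreover have "\<beta> * (a i \<bullet> x) \<le> \<beta> * b i" using x i pos unfolding B by (intro mult_left_mono) auto
      moreover have "s i * (u \<bullet> ?y - k) = \<sigma> i * (d * (u \<bullet> ?y - k))" by (simp add: s_def)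
      moreover have "(1 - \<beta>) * (a i \<bullet> f) = (1 - \<beta>) * b i - (1 - \<beta>) * \<sigma> i"
        by (simp add: \<sigma>_def algebra_simps)
      ultimately have "a i \<bullet> ?y \<le> b i + s i * (u \<bullet> ?y - k)"
        by (simp only: distrib_left distrib_right left_diff_distrib right_diff_distrib mult_1_left mult_1_right mult.commute[of \<beta>])
      then show ?thesis unfolding Some a'_le .
    qed
    then show ?thesis by blast
  qed
  ultimately show ?thesis by blast
qed

lemma lattice_layer_uminus: "lattice_layer (- u) (- k) = lattice_layer u k"
  by (auto simp: lattice_layer_def)

lemma odd_floor_uminus:
  assumes "x \<in> \<int>" "odd \<lfloor>x\<rfloor>"
  shows "odd \<lfloor>- x :: real\<rfloor>"
  using assms by (auto elim!: Ints_cases simp flip: of_int_minus)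

text \<open>The copy extends over at most 1/4 and contains \<open>f\<close> at a height between 0
  and 1/2, so it stays between -1/4 and 3/4 and only the layer \<open>k\<close> matters. If this
  layer has no lattice points, or no part of the copy is below it, a strip suffices; otherwise the
  cone opens towards the side where \<open>B\<close> extends at least as far.\<close>

lemma approximation_along_direction:
  fixes u f :: "real^'n" and k :: int
  assumes u: "u \<in> int_lattice" "odd \<lfloor>u $ l\<rfloor>"
    and B: "polyhedron B" "interior B \<inter> int_lattice = {}" and f: "f \<in> interior B"
    and \<alpha>: "\<alpha> \<ge> 4" and width: "\<And>x y. x \<in> B \<Longrightarrow> y \<in> B \<Longrightarrow> 4 * (u \<bullet> x - u \<bullet> y) \<le> \<alpha>"
    and t: "0 \<le> u \<bullet> f - k" "u \<bullet> f - k \<le> 1 / 2"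
  shows "\<exists>L\<in>Lfree_poly (2 ^ (CARD('n) - 1) + 1). \<forall>x\<in>B. f + (1 / \<alpha>) *\<^sub>R (x - f) \<in> L"
proof -
  define \<beta> where "\<beta> = 1 / \<alpha>"
  have \<beta>: "0 < \<beta>" "\<beta> \<le> 1 / 4" "\<beta> * \<alpha> = 1"
    using \<alpha> by (simp_all add: \<beta>_def divide_le_eq)
  define h where "h x = u \<bullet> x - k" for x
  define t where "t = h f"
  have t: "0 \<le> t" "t \<le> 1 / 2" using t by (simp_all add: t_def h_def)
  have fB: "f \<in> B" using f interior_subset by blast
  have width': "4 * h x - 4 * h y \<le> \<alpha>" if "x \<in> B" "y \<in> B" for x y
    using width[OF that] by (simp add: h_def algebra_simps)
  have hy: "h (f + \<beta> *\<^sub>R (x - f)) = \<beta> * h x + (1 - \<beta>) * t" for x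
    unfolding t_def h_def by (simp add: algebra_simps)
  have bdd: "bdd_above (h ` B)" "bdd_below (h ` B)"
  proof -
    have "h x \<le> h f + \<alpha> / 4" "h f - \<alpha> / 4 \<le> h x" if "x \<in> B" for x
      using width'[OF that fB] width'[OF fB that] by linarith+
    then show "bdd_above (h ` B)" "bdd_below (h ` B)"
      by (auto intro!: bdd_aboveI[where M = "h f + \<alpha> / 4"] bdd_belowI[where m = "h f - \<alpha> / 4"])
  qed
  define H where "H = Sup (h ` B)"
  define G where "G = - Inf (h ` B)"
  have H: "h x \<le> H" if "x \<in> B" for x
    unfolding H_def using bdd that by (intro cSup_upper) auto
  have Hle: "H \<le> y" if "\<And>x. x \<in> B \<Longrightarrow> h x \<le> y" for y
    unfolding H_def using fB that by (intro cSup_least) auto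
  have G: "- G \<le> h x" if "x \<in> B" for x
    unfolding G_def using bdd that cInf_lower[of "h x" "h ` B"] by auto
  have Gle: "y \<le> - G" if "\<And>x. x \<in> B \<Longrightarrow> y \<le> h x" for y
    using fB that cInf_greatest[of "h ` B" y] unfolding G_def by auto
  have GH: "4 * G + 4 * H \<le> \<alpha>"
  proof -
    have "H - \<alpha> / 4 \<le> h y" if "y \<in> B" for y
    proof -
      have "h x \<le> h y + \<alpha> / 4" if "x \<in> B" for x
        using width'[OF that \<open>y \<in> B\<close>] by linarith
      then have "H \<le> h y + \<alpha> / 4" by (rule Hle)
      then show ?thesis by linarith
    qed
    then have "H - \<alpha> / 4 \<le> - G" by (rule Gle)
    then show ?thesis by simp
  qed
  have "u \<noteq> 0" using u(2) by auto
  have strict: "- G < t" "t < H"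
  proof -
    obtain e where e: "e > 0" "cball f e \<subseteq> B"
      using f mem_interior_cball by blast
    define v where "v = (e / norm u) *\<^sub>R u"
    have "f + v \<in> B" "f - v \<in> B"
      using e \<open>u \<noteq> 0\<close> by (auto simp: v_def dist_norm intro!: subsetD[OF e(2)])
    moreover have "h (f + v) = t + u \<bullet> v" "h (f - v) = t - u \<bullet> v"
      by (simp_all add: h_def t_def inner_add_right inner_diff_right)
    moreover have "u \<bullet> v > 0" using e(1) \<open>u \<noteq> 0\<close> by (simp add: v_def)
    ultimately show "- G < t" "t < H"
      using G[of "f - v"] H[of "f + v"] by linarith+
  qed
  have scaled: "- \<beta> * G + (1 - \<beta>) * t \<le> h (f + \<beta> *\<^sub>R (x - f))"
    "h (f + \<beta> *\<^sub>R (x - f)) \<le> \<beta> * H + (1 - \<beta>) * t" if "x \<in> B" for x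
    unfolding hy using mult_left_mono[OF G[OF that], of \<beta>] mult_left_mono[OF H[OF that], of \<beta>] \<beta>(1) by simp_all
  have "\<beta> * (4 * G + 4 * H) \<le> \<beta> * \<alpha>"
    using GH \<beta>(1) by (intro mult_left_mono) auto
  then have quarter: "\<beta> * G + \<beta> * H \<le> 1 / 4" unfolding \<beta>(3) by (simp add: distrib_left)
  have "\<beta> * (- G) \<le> \<beta> * t" using strict(1) \<beta>(1) by (intro mult_left_mono) auto
  then have bt: "- (\<beta> * G) \<le> \<beta> * t" by simp
  have tb: "0 \<le> (1 - \<beta>) * t" using t \<beta> by simp
  have bt0: "0 \<le> \<beta> * t" using \<beta> t by simp
  have H0: "\<beta> * H > 0" using strict(2) t \<beta> by simp
  have top: "\<beta> * H + (1 - \<beta>) * t \<le> 1"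
    using quarter bt t(2) by (simp add: algebra_simps)
  obtain J :: "(real^'n) set set" and a b where J: "finite J" "B = {x. \<forall>j\<in>J. a j \<bullet> x \<le> b j}" "\<And>j. j \<in> J \<Longrightarrow> a j \<noteq> 0"
  proof -
    obtain F where F: "finite F" "B = \<Inter> F" "\<forall>S\<in>F. \<exists>a b. a \<noteq> 0 \<and> S = {x. a \<bullet> x \<le> b}"
      using B(1) unfolding polyhedron_def by blast
    from F(3) obtain a where "\<forall>S\<in>F. \<exists>b. a S \<noteq> 0 \<and> S = {x. a S \<bullet> x \<le> b}"
      by (rule bchoice[THEN exE])
    then obtain b where ab: "\<forall>S\<in>F. a S \<noteq> 0 \<and> S = {x. a S \<bullet> x \<le> b S}"
      by (rule bchoice[THEN exE])
    show thesis
    proof (rule that[of F a b])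
      show "B = {x. \<forall>S\<in>F. a S \<bullet> x \<le> b S}"
        unfolding F(2) using ab by blast
    qed (use F ab in auto)
  qed
  have intB: "interior B = {x. \<forall>j\<in>J. a j \<bullet> x < b j}"
    unfolding J(2) using J by (intro interior_halfspaces) auto
  have free: "\<exists>j\<in>J. b j \<le> a j \<bullet> z" if "z \<in> int_lattice" for z
  proof -
    have "\<not> (\<forall>j\<in>J. a j \<bullet> z < b j)"
      using B(2) that unfolding intB by blast
    then show ?thesis by (simp add: not_less)
  qed
  have f': "a j \<bullet> f < b j" if "j \<in> J" for j
    using f that unfolding intB by blast
  have slab: "\<exists>L\<in>Lfree_poly (2 ^ (CARD('n) - 1) + 1). \<forall>x\<in>B. f + \<beta> *\<^sub>R (x - f) \<in> L"
    if pq: "p < t" "t < q" "\<And>z. z \<in> int_lattice \<Longrightarrow> h z \<le> p \<or> h z \<ge> q"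
      "p \<le> - \<beta> * G + (1 - \<beta>) * t" "\<beta> * H + (1 - \<beta>) * t \<le> q" for p q :: int
  proof
    have "{x. p \<le> h x \<and> h x \<le> q} \<in> Lfree_poly 2"
      using pq unfolding t_def h_def by (intro slab_Lfree_poly[OF u(1), of _ f]) auto
    then show "{x. p \<le> h x \<and> h x \<le> q} \<in> Lfree_poly (2 ^ (CARD('n) - 1) + 1)"
      by (rule Lfree_poly_mono[rotated]) simp
    show "\<forall>x\<in>B. f + \<beta> *\<^sub>R (x - f) \<in> {x. p \<le> h x \<and> h x \<le> q}"
      using scaled pq by fastforce
  qed
  have int: "h z \<in> \<int>" if "z \<in> int_lattice" for z
    using int_lattice_inner[OF u(1) that] by (simp add: h_def)
  consider (empty) "lattice_layer u k = {}"
    | (above) "\<beta> * G \<le> (1 - \<beta>) * t"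
    | (up) "lattice_layer u k \<noteq> {}" "\<beta> * G > (1 - \<beta>) * t" "G \<le> H"
    | (down) "lattice_layer u k \<noteq> {}" "\<beta> * G > (1 - \<beta>) * t" "H < G"
    by linarith
  then have "\<exists>L\<in>Lfree_poly (2 ^ (CARD('n) - 1) + 1). \<forall>x\<in>B. f + \<beta> *\<^sub>R (x - f) \<in> L"
  proof cases
    case empty
    show ?thesis
    proof (rule slab[of "-1" 1])
      fix z :: "real^'n" assume z: "z \<in> int_lattice"
      have "h z \<noteq> 0"
        using empty z unfolding lattice_layer_def h_def by auto
      then show "h z \<le> of_int (-1) \<or> of_int 1 \<le> h z"
        using Ints_le_or_ge[OF int[OF z], of "-1"] Ints_le_or_ge[OF int[OF z], of 0] by auto
    qed (use t top quarter H0 tb in \<open>simp_all add: algebra_simps\<close>)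
  next
    case above
    have "t \<noteq> 0"
    proof
      assume "t = 0"
      then have "0 < \<beta> * G" using strict(1) \<beta>(1) by simp
      then show False using above \<open>t = 0\<close> by simp
    qed
    show ?thesis
    proof (rule slab[of 0 1])
      fix z :: "real^'n" assume z: "z \<in> int_lattice"
      show "h z \<le> of_int 0 \<or> of_int 1 \<le> h z"
        using Ints_le_or_ge[OF int[OF z], of 0] by simp
    qed (use t top above \<open>t \<noteq> 0\<close> in \<open>simp_all add: algebra_simps\<close>)
  next
    case up
    have "\<beta> * G > 0" using up(2) tb by linarith
    then have G0: "G > 0" using \<beta>(1) by (simp add: zero_less_mult_iff)
    have H0': "H > 0" using up(3) G0 by linarith
    have "G * (1 + 1 / H) \<le> G + 1" using up(3) H0' by (simp add: distrib_left)
    then have "\<beta> * (G * (1 + 1 / H)) \<le> \<beta> * (G + 1)" using \<beta>(1) by (intro mult_left_mono) auto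
    also have "\<dots> \<le> 1 - \<beta>" using quarter H0 \<beta>(2) by (simp add: distrib_left)
    also have "\<dots> \<le> (1 - \<beta>) * (1 + t)" using t \<beta>(2) by (simp add: distrib_left)
    finally have ineq: "\<beta> * G * (1 + 1 / H) \<le> (1 - \<beta>) * (1 + t)" by (simp add: mult.assoc)
    show ?thesis
      using up t \<beta> top ineq G0 H0'
      by (intro truncated_cone[OF u J(1,2) free f' up(1), of t H G \<beta>])
        (auto simp: t_def h_def[symmetric] intro: H Hle G Gle)
  next
    case down
    have "\<beta> * G > 0" using down(2) tb by linarith
    then have G0: "G > 0" using \<beta>(1) by (simp add: zero_less_mult_iff)
    have H0': "H > 0" using H0 \<beta>(1) by (simp add: zero_less_mult_iff)
    have "H * (1 + 1 / G) \<le> H + 1" using down(3) G0 by (simp add: distrib_left)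
    then have "\<beta> * (H * (1 + 1 / G)) \<le> \<beta> * (H + 1)" using \<beta>(1) by (intro mult_left_mono) auto
    \<comment> \<open>The tightest estimate: reversing \<open>u\<close> changes \<open>1 + t\<close>
      into \<open>1 - t\<close>, of which only 1/2 is guaranteed. The bounds
      \<open>\<beta> * H \<le> 1 / 8\<close> and \<open>\<beta> \<le> 1 / 4\<close> give equality at
      their extreme values.\<close>
    also have "\<dots> \<le> (1 - \<beta>) * (1 / 2)"
    proof -
      have "\<beta> * H \<le> \<beta> * G" using down(3) \<beta>(1) by (intro mult_left_mono) auto
      then have "\<beta> * H \<le> 1 / 8" using quarter by linarith
      then show ?thesis using \<beta>(2) by (simp add: algebra_simps)
    qed
    also have "\<dots> \<le> (1 - \<beta>) * (1 + - t)" using t \<beta>(2) by (intro mult_left_mono) auto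
    finally have ineq: "\<beta> * H * (1 + 1 / G) \<le> (1 - \<beta>) * (1 + - t)" by (simp add: mult.assoc)
    have u': "- u \<in> int_lattice" "odd \<lfloor>(- u) $ l\<rfloor>"
      using u odd_floor_uminus by (auto simp: int_lattice_def)
    have ne: "lattice_layer (- u) (- k) \<noteq> {}"
      using down(1) unfolding lattice_layer_uminus .
    have h': "(- u) \<bullet> x - of_int (- k) = - h x" for x
      by (simp add: h_def)
    show ?thesis
    proof (rule truncated_cone[OF u' J(1,2) free f' ne, of "- t" G H \<beta>], unfold h')
      show "y \<ge> G" if "\<And>x. x \<in> B \<Longrightarrow> - h x \<le> y" for y
        using Gle[of "- y"] that by fastforce
      show "y \<le> - H" if "\<And>x. x \<in> B \<Longrightarrow> y \<le> - h x" for y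
        using Hle[of "- y"] that by fastforce
      show "\<beta> * G + (1 - \<beta>) * - t \<le> 1" "0 < \<beta> * H - (1 - \<beta>) * - t"
        using quarter tb H0 unfolding mult_minus_right by linarith+
      show "\<beta> * H * (1 + 1 / G) \<le> (1 - \<beta>) * (1 + - t)"
        by (rule ineq)
    qed (use G H G0 H0' \<beta> t in \<open>force simp: t_def\<close>)+
  qed
  then show ?thesis unfolding \<beta>_def .
qed

text \<open>Among the integer directions in which \<open>B\<close> is narrower than
  \<open>w\<close>, one of least \<open>size\<close> has an odd entry, since otherwise its half
  would be integral, smaller and still narrow. The odd entry is what the parity count in a layer
  requires.\<close>

lemma lattice_width_direction:
  fixes B :: "(real^'n) set"
  assumes "lattice_width B < ereal w" "B \<noteq> {}"
  obtains u l where "u \<in> int_lattice" "odd \<lfloor>u $ l\<rfloor>" "\<And>x y. x \<in> B \<Longrightarrow> y \<in> B \<Longrightarrow> u \<bullet> x - u \<bullet> y < w"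
proof -
  define P where "P u \<longleftrightarrow> u \<in> int_lattice \<and> u \<noteq> 0 \<and> (\<forall>x\<in>B. \<forall>y\<in>B. u \<bullet> x - u \<bullet> y < w)" for u
  define size where "size u = (\<Sum>i\<in>UNIV. nat \<bar>\<lfloor>u $ i\<rfloor>\<bar>)" for u :: "real^'n"
  obtain u where u: "u \<in> int_lattice - {0}" "(SUP x\<in>B. ereal (u \<bullet> x)) - (INF x\<in>B. ereal (u \<bullet> x)) < ereal w"
    using assms(1) unfolding lattice_width_def by (auto simp: INF_less_iff)
  have "u \<bullet> x - u \<bullet> y < w" if "x \<in> B" "y \<in> B" for x y
  proof -
    have "ereal (u \<bullet> x) - ereal (u \<bullet> y) \<le> (SUP x\<in>B. ereal (u \<bullet> x)) - (INF x\<in>B. ereal (u \<bullet> x))"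
      using that by (intro ereal_minus_mono SUP_upper INF_lower)
    then have "ereal (u \<bullet> x) - ereal (u \<bullet> y) < ereal w"
      using u(2) by (rule order.strict_trans1)
    then show ?thesis by simp
  qed
  then have "P u" using u(1) by (simp add: P_def)
  then obtain u where Pu: "P u" and least: "\<And>v. P v \<Longrightarrow> size u \<le> size v"
    using ex_has_least_nat[of P u size] by blast
  have "\<exists>l. odd \<lfloor>u $ l\<rfloor>"
  proof (rule ccontr)
    assume "\<not> (\<exists>l. odd \<lfloor>u $ l\<rfloor>)"
    then have even: "\<And>i. even \<lfloor>u $ i\<rfloor>" by blast
    define v where "v = (\<chi> i. real_of_int (\<lfloor>u $ i\<rfloor> div 2))"
    have "u $ i \<in> \<int>" for i
      using Pu unfolding P_def int_lattice_def by blast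
    then have "u $ i = of_int \<lfloor>u $ i\<rfloor>" for i
      by (metis Ints_cases floor_of_int)
    then have uv_i: "u $ i = 2 * v $ i" for i
      using even[of i] unfolding v_def by (metis dvd_mult_div_cancel of_int_mult of_int_numeral vec_lambda_beta)
    then have uv: "u = 2 *\<^sub>R v" by (simp add: vec_eq_iff)
    have "v \<in> int_lattice" by (simp add: v_def int_lattice_def)
    moreover have "v \<noteq> 0" using Pu uv unfolding P_def by auto
    moreover have "v \<bullet> x - v \<bullet> y < w" if xy: "x \<in> B" "y \<in> B" for x y
    proof -
      define d where "d = v \<bullet> x - v \<bullet> y"
      have "u \<bullet> x - u \<bullet> y < w" "u \<bullet> y - u \<bullet> x < w"
        using Pu xy unfolding P_def by blast+
      then have "2 * d < w" "- (2 * d) < w"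
        unfolding uv d_def by simp_all
      then show ?thesis unfolding d_def[symmetric] by linarith
    qed
    ultimately have "P v" by (simp add: P_def)
    then have "size u \<le> size v" by (rule least)
    have le: "nat \<bar>\<lfloor>v $ i\<rfloor>\<bar> \<le> nat \<bar>\<lfloor>u $ i\<rfloor>\<bar>" for i
      using even[of i] unfolding v_def by (auto elim!: evenE)
    obtain i where i: "v $ i \<noteq> 0" using \<open>v \<noteq> 0\<close> by (auto simp: vec_eq_iff)
    have "nat \<bar>\<lfloor>v $ i\<rfloor>\<bar> < nat \<bar>\<lfloor>u $ i\<rfloor>\<bar>"
      using i even[of i] unfolding v_def by (auto elim!: evenE)
    then have "size v < size u"
      unfolding size_def using le by (intro sum_strict_mono_ex1) auto
    then show False using \<open>size u \<le> size v\<close> by linarith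
  qed
  then show thesis using that Pu unfolding P_def by blast
qed

lemma approximation_lattice_width:
  fixes f :: "real^'n"
  assumes B: "polyhedron B" "interior B \<inter> int_lattice = {}" and f: "f \<in> interior B"
    and \<alpha>: "\<alpha> \<ge> 4" and width: "4 * lattice_width B < ereal \<alpha>"
  shows "\<exists>L\<in>Lfree_poly (2 ^ (CARD('n) - 1) + 1). \<forall>x\<in>B. f + (1 / \<alpha>) *\<^sub>R (x - f) \<in> L"
proof -
  have "lattice_width B < ereal (\<alpha> / 4)"
    using width by (cases "lattice_width B") auto
  moreover have "B \<noteq> {}" using f by auto
  ultimately obtain u l where u: "u \<in> int_lattice" "odd \<lfloor>u $ l\<rfloor>"
    and w: "\<And>x y. x \<in> B \<Longrightarrow> y \<in> B \<Longrightarrow> u \<bullet> x - u \<bullet> y < \<alpha> / 4"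
    using lattice_width_direction by blast
  have w1: "4 * (u \<bullet> x - u \<bullet> y) \<le> \<alpha>" and w2: "4 * ((- u) \<bullet> x - (- u) \<bullet> y) \<le> \<alpha>"
    if "x \<in> B" "y \<in> B" for x y
    using w[OF that] w[OF that(2,1)] by simp_all
  have u': "- u \<in> int_lattice" "odd \<lfloor>(- u) $ l\<rfloor>"
    using u odd_floor_uminus by (auto simp: int_lattice_def)
  \<comment> \<open>The nearest layer; if \<open>f\<close> lies below it, passing to
    \<open>- u\<close> and \<open>- k\<close> gives \<open>f\<close> a height between 0 and
    1/2.\<close>
  define k where "k = round (u \<bullet> f)"
  have k: "\<bar>u \<bullet> f - k\<bar> \<le> 1 / 2"
    unfolding k_def using of_int_round_abs_le[of "u \<bullet> f"] by (simp add: abs_minus_commute)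
  show ?thesis
  proof (cases "0 \<le> u \<bullet> f - k")
    case True
    then show ?thesis
      using k by (intro approximation_along_direction[OF u B f \<alpha> w1, of k]) auto
  next
    case False
    then show ?thesis
      using k by (intro approximation_along_direction[OF u' B f \<alpha> w2, of "- k"]) auto
  qed
qed

text \<open>Makes every real bound \<alpha> on \<open>4 * Flt\<close> at least 4, so that the
  shrinking factor is at most 1/4. The unit strip contains the origin and all unit vectors, and each
  nonzero integer \<open>v\<close> varies by at least 1 between some of them.\<close>

lemma Flt_ge_1: "Flt TYPE('n::finite) \<ge> 1"
proof -
  define l :: 'n where "l = undefined"
  define u :: "real^'n" where "u = axis l 1"
  have u: "u \<in> int_lattice" by (auto simp: u_def int_lattice_def axis_def)
  have ux: "u \<bullet> x = x $ l" for x by (simp add: u_def inner_axis')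
  define S where "S = {x :: real^'n. 0 \<le> x $ l \<and> x $ l \<le> 1}"
  have "{x. of_int 0 \<le> u \<bullet> x - of_int 0 \<and> u \<bullet> x - of_int 0 \<le> of_int 1} \<in> Lfree_poly 2"
  proof (rule slab_Lfree_poly[OF u, of _ "axis l (1 / 2)"])
    fix z :: "real^'n" assume "z \<in> int_lattice"
    then have "z $ l \<in> \<int>" unfolding int_lattice_def by simp
    then show "u \<bullet> z - of_int 0 \<le> of_int 0 \<or> of_int 1 \<le> u \<bullet> z - of_int 0"
      unfolding ux using Ints_le_or_ge[of "z $ l" 0] by simp
  qed (simp_all add: ux)
  then have S: "lattice_free S" by (simp add: S_def ux Lfree_poly_def)
  have "1 \<le> lattice_width S"
    unfolding lattice_width_def
  proof (rule INF_greatest)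
    fix v :: "real^'n" assume v: "v \<in> int_lattice - {0}"
    have lower: "ereal (v \<bullet> x - v \<bullet> y) \<le> (SUP x\<in>S. ereal (v \<bullet> x)) - (INF x\<in>S. ereal (v \<bullet> x))"
      if "x \<in> S" "y \<in> S" for x y
      unfolding ereal_minus(1)[symmetric] using that by (intro ereal_minus_mono SUP_upper INF_lower)
    obtain x y where xy: "x \<in> S" "y \<in> S" "1 \<le> v \<bullet> x - v \<bullet> y"
    proof -
      obtain i where i: "v $ i \<noteq> 0" using v by (auto simp: vec_eq_iff)
      have "v $ i \<in> \<int>" using v by (simp add: int_lattice_def)
      then have vi: "\<bar>v $ i\<bar> \<ge> 1" using i by (rule Ints_nonzero_abs_ge1)
      have in_S: "axis i 1 \<in> S" "0 \<in> S" by (auto simp: S_def axis_def)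
      show thesis
      proof (cases "v $ i > 0")
        case True
        then show thesis using that[OF in_S] vi by (simp add: inner_axis)
      next
        case False
        then show thesis using that[OF in_S(2,1)] vi by (simp add: inner_axis)
      qed
    qed
    have "1 \<le> ereal (v \<bullet> x - v \<bullet> y)" using xy(3) by simp
    then show "1 \<le> (SUP x\<in>S. ereal (v \<bullet> x)) - (INF x\<in>S. ereal (v \<bullet> x))"
      using lower[OF xy(1,2)] by (rule order_trans)
  qed
  then show ?thesis
    unfolding Flt_def using S by (intro order_trans[OF _ SUP_upper[of S]]) auto
qed

text \<open>One approximating \<open>L\<close> per \<open>B\<close> is enough: the condition that
  \<open>L\<close> imposes on \<open>s\<close> becomes, by comparison of gauges, the condition that
  \<open>B\<close> imposes on \<open>\<alpha> * s\<close>.\<close>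

lemma C_fam_subset_scaled:
  fixes f :: "real^'n"
  assumes \<alpha>: "\<alpha> > 0"
    and approx: "\<And>B. B \<in> \<L> \<Longrightarrow> f \<in> interior B \<Longrightarrow> \<exists>L\<in>\<B>. f \<in> interior L \<and> (\<forall>x\<in>B. f + (1 / \<alpha>) *\<^sub>R (x - f) \<in> L)"
  shows "C_fam \<B> k R f \<subseteq> (\<lambda>s j. s j / \<alpha>) ` C_fam \<L> k R f"
proof
  fix s assume s: "s \<in> C_fam \<B> k R f"
  define s' where "s' j = \<alpha> * s j" for j
  have nn: "s \<in> nonneg_orthant k" using s by (simp add: C_fam_def)
  then have nn': "s' \<in> nonneg_orthant k"
    using \<alpha> by (auto simp: nonneg_orthant_def s'_def)
  have "s' \<in> C_set B k R f" if B: "B \<in> \<L>" for B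
  proof (cases "f \<in> interior B")
    case True
    then obtain L where L: "L \<in> \<B>" "f \<in> interior L" "\<And>x. x \<in> B \<Longrightarrow> f + (1 / \<alpha>) *\<^sub>R (x - f) \<in> L"
      using approx[OF B] by blast
    have "s \<in> C_set L k R f" using s L(1) unfolding C_fam_def by blast
    then have "1 \<le> (\<Sum>j<k. s j * gauge_fn ((\<lambda>x. x - f) ` L) (R j))"
      using L(2) by (simp add: C_set_def)
    also have "\<dots> \<le> (\<Sum>j<k. s' j * gauge_fn ((\<lambda>x. x - f) ` B) (R j))"
    proof (rule sum_mono)
      fix j assume "j \<in> {..<k}"
      then have "s j * gauge_fn ((\<lambda>x. x - f) ` L) (R j) \<le> s j * (\<alpha> * gauge_fn ((\<lambda>x. x - f) ` B) (R j))"
        using nn gauge_fn_le_scaled[OF \<alpha> True L(3)]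
        by (intro mult_left_mono) (auto simp: nonneg_orthant_def)
      then show "s j * gauge_fn ((\<lambda>x. x - f) ` L) (R j) \<le> s' j * gauge_fn ((\<lambda>x. x - f) ` B) (R j)"
        by (simp add: s'_def mult_ac)
    qed
    finally show ?thesis using True nn' by (simp add: C_set_def)
  qed (use nn' in \<open>simp add: C_set_def\<close>)
  then have "s' \<in> C_fam \<L> k R f" using nn' by (simp add: C_fam_def)
  moreover have "s = (\<lambda>j. s' j / \<alpha>)" using \<alpha> by (simp add: s'_def)
  ultimately show "s \<in> (\<lambda>s j. s j / \<alpha>) ` C_fam \<L> k R f" by blast
qed

lemma rho_le_Flt:
  assumes "2 ^ (CARD('n::finite) - 1) < i"
  shows "rho (Lfree_poly i :: (real^'n) set set) Lfree_poly_all \<le> 4 * Flt TYPE('n)"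
  unfolding rho_def
proof (rule SUP_least, rule ereal_le_real)
  fix f :: "real^'n" and \<alpha>
  assume \<alpha>: "4 * Flt TYPE('n) \<le> ereal \<alpha>"
  show "rho_f (Lfree_poly i) Lfree_poly_all f \<le> ereal \<alpha>"
  \<comment> \<open>The lattice width is an infimum; the margin \<open>e\<close> gives a strict
    bound, which some integer direction satisfies.\<close>
  proof (rule ereal_le_epsilon2)
    fix e :: real assume e: "0 < e"
    have "4 * (1::ereal) \<le> 4 * Flt TYPE('n)"
      using Flt_ge_1 by (intro ereal_mult_left_mono) auto
    then have "ereal 4 \<le> ereal \<alpha>" using \<alpha> order_trans by fastforce
    then have "\<alpha> \<ge> 4" by simp
    have "\<exists>L\<in>Lfree_poly i. f \<in> interior L \<and> (\<forall>x\<in>B. f + (1 / (\<alpha> + e)) *\<^sub>R (x - f) \<in> L)"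
      if B: "B \<in> Lfree_poly_all" "f \<in> interior B" for B
    proof -
      have "lattice_width B \<le> Flt TYPE('n)"
        using B(1) unfolding Flt_def Lfree_poly_all_def by (intro SUP_upper) auto
      then have "4 * lattice_width B \<le> 4 * Flt TYPE('n)"
        by (intro ereal_mult_left_mono) auto
      then have "4 * lattice_width B \<le> ereal \<alpha>" using \<alpha> by (rule order_trans)
      also have "\<dots> < ereal (\<alpha> + e)" using e by simp
      finally have "4 * lattice_width B < ereal (\<alpha> + e)" .
      then obtain L where L: "L \<in> Lfree_poly (2 ^ (CARD('n) - 1) + 1)" "\<forall>x\<in>B. f + (1 / (\<alpha> + e)) *\<^sub>R (x - f) \<in> L"
        using approximation_lattice_width[of B f "\<alpha> + e"] B \<open>\<alpha> \<ge> 4\<close> e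
        unfolding Lfree_poly_all_def lattice_free_def by auto
      have "L \<in> Lfree_poly i" using assms by (intro Lfree_poly_mono[OF _ L(1)]) simp
      moreover have "f \<in> interior L"
      proof -
        obtain d where d: "d > 0" "ball f d \<subseteq> B" using B(2) mem_interior by blast
        have "ball f (d / (\<alpha> + e)) \<subseteq> L"
        proof
          fix y assume "y \<in> ball f (d / (\<alpha> + e))"
          then have "norm (y - f) * (\<alpha> + e) < d"
            using \<open>\<alpha> \<ge> 4\<close> e by (simp add: dist_norm norm_minus_commute pos_less_divide_eq)
          then have "f + (\<alpha> + e) *\<^sub>R (y - f) \<in> ball f d"
            using \<open>\<alpha> \<ge> 4\<close> e by (simp add: dist_norm mult.commute)
          then have "f + (1 / (\<alpha> + e)) *\<^sub>R ((f + (\<alpha> + e) *\<^sub>R (y - f)) - f) \<in> L"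
            using d(2) L(2) by blast
          then show "y \<in> L" using \<open>\<alpha> \<ge> 4\<close> e by simp
        qed
        then show ?thesis using d(1) \<open>\<alpha> \<ge> 4\<close> e by (auto simp: mem_interior intro!: exI[of _ "d / (\<alpha> + e)"])
      qed
      ultimately show ?thesis using L(2) by blast
    qed
    then have "C_fam (Lfree_poly i) k R f \<subseteq> (\<lambda>s j. s j / (\<alpha> + e)) ` C_fam Lfree_poly_all k R f" for k R
      using \<open>\<alpha> \<ge> 4\<close> e by (intro C_fam_subset_scaled) auto
    then have "rho_f (Lfree_poly i) Lfree_poly_all f \<le> ereal (\<alpha> + e)"
      unfolding rho_f_def using \<open>\<alpha> \<ge> 4\<close> e by (intro Inf_lower) auto
    then show "rho_f (Lfree_poly i) Lfree_poly_all f \<le> ereal \<alpha> + ereal e" by simp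
  qed
qed

subsection \<open>Partitions of the cube\<close>

text \<open>Vertices of the cube over a coordinate set \<open>U\<close> are coded by subsets of \<open>U\<close>; the pair
  \<open>(D, S)\<close> stands for the face in which the coordinates in \<open>D\<close> are fixed, to 1 on \<open>S\<close> and to 0 elsewhere.\<close>
definition cube_partition :: "'a set \<Rightarrow> ('a set \<times> 'a set) set \<Rightarrow> bool" where
  "cube_partition U P \<longleftrightarrow>
     (\<forall>p\<in>P. snd p \<subseteq> fst p \<and> fst p \<subseteq> U) \<and>
     (\<forall>V\<subseteq>U. \<exists>p\<in>P. V \<inter> fst p = snd p) \<and>
     (\<forall>p\<in>P. \<forall>q\<in>P. \<forall>V\<subseteq>U. V \<inter> fst p = snd p \<longrightarrow> V \<inter> fst q = snd q \<longrightarrow> p = q)"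

lemma cube_partitionD:
  assumes "cube_partition U P"
  shows "p \<in> P \<Longrightarrow> snd p \<subseteq> fst p" "p \<in> P \<Longrightarrow> fst p \<subseteq> U"
    "V \<subseteq> U \<Longrightarrow> \<exists>p\<in>P. V \<inter> fst p = snd p"
    "p \<in> P \<Longrightarrow> q \<in> P \<Longrightarrow> V \<subseteq> U \<Longrightarrow> V \<inter> fst p = snd p \<Longrightarrow> V \<inter> fst q = snd q \<Longrightarrow> p = q"
proof -
  note part = assms[unfolded cube_partition_def]
  show "p \<in> P \<Longrightarrow> snd p \<subseteq> fst p" "p \<in> P \<Longrightarrow> fst p \<subseteq> U"
    using part[THEN conjunct1] by simp_all
  show "\<exists>p\<in>P. V \<inter> fst p = snd p" if "V \<subseteq> U"
    using part[THEN conjunct2, THEN conjunct1, rule_format, OF that] .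
  show "p = q" if "p \<in> P" "q \<in> P" "V \<subseteq> U" "V \<inter> fst p = snd p" "V \<inter> fst q = snd q"
    using part[THEN conjunct2, THEN conjunct2, rule_format, OF that] .
qed

text \<open>While there are fewer than \<open>2 ^ card U\<close> faces, one of them has a free
  coordinate \<open>k\<close>. Splitting it at \<open>k\<close> adds exactly one face, so every
  count up to the number of vertices occurs.\<close>

lemma ex_cube_partition:
  assumes "finite U" "1 \<le> i" "i \<le> 2 ^ card U"
  shows "\<exists>P. finite P \<and> card P = i \<and> cube_partition U P"
  using assms(2,3)
proof (induction i rule: nat_induct_at_least)
  case base
  have "cube_partition U {({}, {})}"
    by (simp add: cube_partition_def)
  then show ?case
    by (intro exI[of _ "{({}, {})}"]) simp
next
  case (Suc i)
  then obtain P where P: "finite P" "card P = i" "cube_partition U P"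
    by auto
  note part = cube_partitionD[OF P(3)]
  have "\<exists>p\<in>P. fst p \<noteq> U"
  proof (rule ccontr)
    assume all: "\<not> (\<exists>p\<in>P. fst p \<noteq> U)"
    have "Pow U \<subseteq> snd ` P"
    proof
      fix V assume "V \<in> Pow U"
      then obtain p where "p \<in> P" "V \<inter> fst p = snd p"
        using part(3) by blast
      then show "V \<in> snd ` P"
        using all \<open>V \<in> Pow U\<close> by (metis PowD image_eqI inf.absorb1)
    qed
    then have "card (Pow U) \<le> card P"
      using P(1) by (meson card_image_le card_mono finite_imageI le_trans)
    then show False
      using Suc.prems P(2) assms(1) by (simp add: card_Pow)
  qed
  then obtain D S where DS: "(D, S) \<in> P" "D \<noteq> U"
    by (metis prod.collapse)
  then have sub: "S \<subseteq> D" "D \<subseteq> U"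
    using part(1,2)[OF DS(1)] by auto
  obtain k where k: "k \<in> U" "k \<notin> D"
    using sub DS(2) by blast
  define p0 where "p0 = (insert k D, S)"
  define p1 where "p1 = (insert k D, insert k S)"
  define Q where "Q = insert p0 (insert p1 (P - {(D, S)}))"
  have "k \<notin> S" using k sub by blast
  have match: "V \<inter> D = S \<longleftrightarrow> V \<inter> fst p0 = snd p0 \<or> V \<inter> fst p1 = snd p1" for V
    using k \<open>k \<notin> S\<close> unfolding p0_def p1_def by auto
  have ne: "p0 \<noteq> p1"
    using \<open>k \<notin> S\<close> unfolding p0_def p1_def by blast
  have "p0 \<notin> P"
  proof
    assume "p0 \<in> P"
    then have "p0 = (D, S)"
      by (rule part(4)[OF _ DS(1), of _ S]) (use sub \<open>k \<notin> S\<close> in \<open>auto simp: p0_def\<close>)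
    then show False using k unfolding p0_def by auto
  qed
  moreover have "p1 \<notin> P"
  proof
    assume "p1 \<in> P"
    then have "p1 = (D, S)"
      by (rule part(4)[OF _ DS(1), of _ "insert k S"]) (use sub k in \<open>auto simp: p1_def\<close>)
    then show False using k unfolding p1_def by auto
  qed
  moreover have "card (P - {(D, S)}) = i - 1"
    using P(1,2) DS(1) by simp
  moreover have "i \<ge> 1"
    using Suc.hyps by simp
  ultimately have "card Q = Suc i"
    unfolding Q_def using P(1) ne by simp
  moreover have "finite Q"
    unfolding Q_def using P(1) by simp
  moreover have "cube_partition U Q"
    unfolding cube_partition_def
  proof (intro conjI ballI allI impI)
    fix p assume "p \<in> Q"
    then consider "p = p0" | "p = p1" | "p \<in> P"
      unfolding Q_def by blast
    then have "snd p \<subseteq> fst p \<and> fst p \<subseteq> U"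
      by cases (use part(1,2)[of p] sub k(1) in \<open>auto simp: p0_def p1_def\<close>)
    then show "snd p \<subseteq> fst p" "fst p \<subseteq> U"
      by simp_all
  next
    fix V assume "V \<subseteq> U"
    then obtain p where p: "p \<in> P" "V \<inter> fst p = snd p"
      using part(3) by blast
    show "\<exists>p\<in>Q. V \<inter> fst p = snd p"
    proof (cases "p = (D, S)")
      case True
      then show ?thesis using p(2) match[of V] unfolding Q_def by auto
    next
      case False
      then show ?thesis using p unfolding Q_def by blast
    qed
  next
    fix p q V
    assume pq: "p \<in> Q" "q \<in> Q" "V \<subseteq> U" "V \<inter> fst p = snd p" "V \<inter> fst q = snd q"
    have excl: "\<not> (V \<inter> fst p0 = snd p0 \<and> V \<inter> fst p1 = snd p1)"
      using \<open>k \<notin> S\<close> unfolding p0_def p1_def by auto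
    have old: "r = (D, S)" if "r \<in> P" "V \<inter> fst r = snd r" "V \<inter> D = S" for r
      using part(4)[OF that(1) DS(1) pq(3) that(2)] that(3) by simp
    have new: "r = p0 \<or> r = p1" if "r \<in> Q" "V \<inter> fst r = snd r" "V \<inter> D = S" for r
      using old[OF _ that(2,3)] that(1) unfolding Q_def by blast
    show "p = q"
    proof (cases "V \<inter> D = S")
      case True
      then have "p = p0 \<or> p = p1" "q = p0 \<or> q = p1"
        using new pq by simp_all
      then show ?thesis using excl pq(4,5) by metis
    next
      case False
      then have "p \<noteq> p0" "p \<noteq> p1" "q \<noteq> p0" "q \<noteq> p1"
        using match[of V] pq(4,5) by blast+
      then have "p \<in> P" "q \<in> P"
        using pq(1,2) unfolding Q_def by simp_all
      then show ?thesis by (rule part(4)[OF _ _ pq(3-5)])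
    qed
  qed
  ultimately show ?case by blast
qed

text \<open>A face without fixed coordinates is the whole cube and leaves no room for a second one.
  This makes the facet heights \<open>card (fst p) / 2\<close> positive.\<close>

lemma cube_partition_proper:
  assumes "cube_partition U P" "2 \<le> card P" "p \<in> P"
  shows "fst p \<noteq> {}"
proof
  assume "fst p = {}"
  note part = cube_partitionD[OF assms(1)]
  have "q = p" if "q \<in> P" for q
    using part(1,2)[OF that] part(1)[OF assms(3)] \<open>fst p = {}\<close>
    by (intro part(4)[OF that assms(3), of "snd q"]) auto
  then have "P \<subseteq> {p}" by blast
  then have "card P \<le> card {p}" by (rule card_mono[rotated]) simp
  then show False using assms(2) by simp
qed

text \<open>For \<open>snd p \<subseteq> fst p\<close>, the functional that, measured from the
  centre, attains its maximum \<open>card (fst p) / 2\<close> over the cube exactly on the face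
  \<open>p\<close>.\<close>

definition face_normal :: "'n set \<times> 'n set \<Rightarrow> real^'n" where
  "face_normal p = (\<chi> k. if k \<in> fst p then if k \<in> snd p then 1 else - 1 else 0)"

text \<open>The vertex of the face \<open>p\<close> whose free coordinates are 0; it serves as the
  private lattice point of the facet belonging to \<open>p\<close>.\<close>

definition cube_vertex :: "'n set \<times> 'n set \<Rightarrow> real^'n" where
  "cube_vertex p = (\<chi> k. if k \<in> snd p then 1 else 0)"

definition cube_center :: "real^'n" where
  "cube_center = (\<chi> k. 1 / 2)"

lemma face_normal_inner:
  "face_normal p \<bullet> y = (\<Sum>k\<in>fst p. (if k \<in> snd p then 1 else - 1) * y $ k)"
proof -
  have "face_normal p \<bullet> y = (\<Sum>k\<in>UNIV. if k \<in> fst p then (if k \<in> snd p then 1 else - 1) * y $ k else 0)"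
    unfolding inner_vec_def face_normal_def by (intro sum.cong) auto
  then show ?thesis by (simp add: sum.If_cases)
qed

lemma cube_vertex_lattice: "cube_vertex p \<in> int_lattice"
  by (simp add: cube_vertex_def int_lattice_def)

lemma face_normal_own_vertex:
  "face_normal p \<bullet> (cube_vertex p - cube_center) = card (fst p) / 2"
proof -
  have "face_normal p \<bullet> (cube_vertex p - cube_center) = (\<Sum>k\<in>fst p. 1 / 2)"
    unfolding face_normal_inner by (intro sum.cong) (auto simp: cube_vertex_def cube_center_def)
  then show ?thesis by simp
qed

text \<open>Faces of the partition are disjoint, so a vertex of \<open>p\<close> is wrong in some
  coordinate fixed by \<open>q\<close>, where the contribution drops from 1/2 to -1/2. This gap is
  the slack available to midpoints.\<close>

lemma face_normal_other_vertex:
  assumes "cube_partition U P" "p \<in> P" "q \<in> P" "p \<noteq> q"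
  shows "face_normal q \<bullet> (cube_vertex p - cube_center) \<le> card (fst q) / 2 - 1"
proof -
  note part = cube_partitionD[OF assms(1)]
  have "snd p \<inter> fst q \<noteq> snd q"
    using part(4)[OF assms(2,3), of "snd p"] part(1,2)[OF assms(2)] assms(4) by blast
  then obtain k where k: "k \<in> fst q" "k \<in> snd p \<longleftrightarrow> k \<notin> snd q"
    using part(1)[OF assms(3)] by blast
  let ?t = "\<lambda>k. (if k \<in> snd q then 1 else - 1) * (cube_vertex p - cube_center) $ k"
  have "face_normal q \<bullet> (cube_vertex p - cube_center) = ?t k + (\<Sum>k\<in>fst q - {k}. ?t k)"
    unfolding face_normal_inner using k(1) by (intro sum.remove) auto
  also have "\<dots> \<le> - 1 / 2 + (\<Sum>k\<in>fst q - {k}. 1 / 2)"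
    using k(2) by (intro add_mono sum_mono) (auto simp: cube_vertex_def cube_center_def)
  also have "\<dots> = card (fst q) / 2 - 1"
  proof -
    have "card (fst q) \<ge> 1" using k(1) by (simp add: Suc_le_eq card_gt_0_iff) blast
    then show ?thesis using k(1) by (simp add: of_nat_diff field_simps)
  qed
  finally show ?thesis .
qed

text \<open>Each integer is at least 1 or at most 0, so replacing the entries of \<open>z\<close> by
  1 or 0 accordingly gives a vertex of the cube. For the face \<open>p\<close> containing it, every
  fixed coordinate of \<open>z\<close> is at least 1/2 from the centre, on the correct side.\<close>

lemma face_normal_lattice_cover:
  assumes "cube_partition U P" "z \<in> int_lattice"
  shows "\<exists>p\<in>P. card (fst p) / 2 \<le> face_normal p \<bullet> (z - cube_center)"
proof -
  note part = cube_partitionD[OF assms(1)]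
  obtain p where p: "p \<in> P" "{k \<in> U. 1 \<le> z $ k} \<inter> fst p = snd p"
    using part(3)[of "{k \<in> U. 1 \<le> z $ k}"] by blast
  have "(\<Sum>k\<in>fst p. 1 / 2) \<le> face_normal p \<bullet> (z - cube_center)"
    unfolding face_normal_inner
  proof (rule sum_mono)
    fix k assume k: "k \<in> fst p"
    have "z $ k \<in> \<int>" using assms(2) by (simp add: int_lattice_def)
    then have "z $ k \<le> 0 \<or> 1 \<le> z $ k" using Ints_le_or_ge[of "z $ k" 0] by simp
    moreover have "k \<in> snd p \<longleftrightarrow> 1 \<le> z $ k"
      using p(2) k part(2)[OF p(1)] by blast
    ultimately show "1 / 2 \<le> (if k \<in> snd p then 1 else - 1) * (z - cube_center) $ k"
      by (auto simp: cube_center_def)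
  qed
  then show ?thesis using p(1) by (intro bexI[of _ p]) auto
qed

subsection \<open>The lower bound\<close>

text \<open>If all the points \<open>f + 2 (m p q - f)\<close> belong to \<open>L\<close>, then \<open>L\<close> needs a separate facet for each
  \<open>v p\<close>. So there are no other facets, and all of them are descending in the direction \<open>- e\<close>.\<close>
lemma few_facets_miss_point:
  fixes v :: "'p \<Rightarrow> real^'n"
  assumes L: "L \<in> Lfree_poly i" "f \<in> interior L"
    and P: "finite P" "card P = i" "P \<noteq> {}" "\<And>p. p \<in> P \<Longrightarrow> v p \<in> int_lattice"
    and e: "e \<in> int_lattice" and \<tau>: "\<tau> > 0"
    and mid: "\<And>p q. p \<in> P \<Longrightarrow> q \<in> P \<Longrightarrow> p \<noteq> q \<Longrightarrow> m p q = (1/2) *\<^sub>R (v p + v q)"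
    and low: "\<And>p. p \<in> P \<Longrightarrow> m p p = v p - \<tau> *\<^sub>R e"
  shows "\<exists>p\<in>P. \<exists>q\<in>P. f + 2 *\<^sub>R (m p q - f) \<notin> L"
proof (rule ccontr)
  assume "\<not> ?thesis"
  then have all: "f + 2 *\<^sub>R (m p q - f) \<in> L" if "p \<in> P" "q \<in> P" for p q
    using that by blast
  define F where "F = {C. C facet_of L}"
  have L': "polyhedron L" "finite F" "card F \<le> i" "interior L \<inter> int_lattice = {}"
    using L(1) unfolding Lfree_poly_def lattice_free_def F_def by auto
  have ne: "interior L \<noteq> {}" using L(2) by blast
  obtain a b where a: "\<And>C. C \<in> F \<Longrightarrow> a C \<noteq> 0" and L_eq: "L = {x. \<forall>C\<in>F. a C \<bullet> x \<le> b C}"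
    using polyhedron_facet_halfspaces[OF L'(1) ne] unfolding F_def by auto
  have int: "interior L = {x. \<forall>C\<in>F. a C \<bullet> x < b C}"
    using interior_halfspaces[OF L'(2) a] L_eq by simp
  \<comment> \<open>\<open>m p q\<close> is halfway between the interior point \<open>f\<close> and
    a point of \<open>L\<close>, hence interior; this is the origin of the factor 2.\<close>
  have m_int: "a C \<bullet> m p q < b C" if "p \<in> P" "q \<in> P" "C \<in> F" for p q C
  proof -
    have "a C \<bullet> f < b C" using L(2) that(3) unfolding int by blast
    moreover have "a C \<bullet> (f + 2 *\<^sub>R (m p q - f)) \<le> b C"
      using all[OF that(1,2)] that(3) unfolding L_eq by blast
    ultimately show ?thesis by (simp add: inner_add_right inner_diff_right)
  qed
  have "\<exists>C. C \<in> F \<and> b C \<le> a C \<bullet> v p" if "p \<in> P" for p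
  proof -
    have "v p \<notin> interior L" using L'(4) P(4)[OF that] by blast
    then show ?thesis unfolding int by (auto simp: not_less)
  qed
  then obtain C where C: "\<And>p. p \<in> P \<Longrightarrow> C p \<in> F" "\<And>p. p \<in> P \<Longrightarrow> b (C p) \<le> a (C p) \<bullet> v p"
    by metis
  \<comment> \<open>An inequality violated or tight at both \<open>v p\<close> and
    \<open>v q\<close> would not be strict at their midpoint, which is interior.\<close>
  have "inj_on C P"
  proof (rule inj_onI, rule ccontr)
    fix p q assume pq: "p \<in> P" "q \<in> P" "C p = C q" "p \<noteq> q"
    have "a (C p) \<bullet> m p q < b (C p)" using m_int pq C(1) by blast
    then have "a (C p) \<bullet> v p + a (C p) \<bullet> v q < 2 * b (C p)"
      unfolding mid[OF pq(1,2,4)] by (simp add: inner_add_right)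
    then show False using C(2)[OF pq(1)] C(2)[OF pq(2)] unfolding pq(3) by linarith
  qed
  then have "card (C ` P) = i" using P(2) by (simp add: card_image)
  moreover have "C ` P \<subseteq> F" using C(1) by blast
  ultimately have F: "F = C ` P" using L'(2,3) by (metis card_seteq)
  \<comment> \<open>Each facet separates some \<open>v p\<close> from the interior point
    \<open>m p p\<close>, which differs from it by a negative multiple of \<open>e\<close>.\<close>
  have ae: "a D \<bullet> e > 0" if D: "D \<in> F" for D
  proof -
    obtain p where p: "p \<in> P" "D = C p" using D F by blast
    have "a D \<bullet> (v p - \<tau> *\<^sub>R e) < b D" using m_int[OF p(1) p(1) D] low[OF p(1)] by simp
    moreover have "b D \<le> a D \<bullet> v p" using C(2)[OF p(1)] p(2) by simp
    ultimately have "0 < \<tau> * (a D \<bullet> e)" by (simp add: inner_diff_right)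
    then show ?thesis using \<tau> by (simp add: zero_less_mult_iff)
  qed
  obtain p where p: "p \<in> P" using P(3) by blast
  define r where "r D = (a D \<bullet> v p - b D) / (a D \<bullet> e)" for D
  obtain N :: nat where N: "(\<Sum>D\<in>F. \<bar>r D\<bar>) < real N" using reals_Archimedean2 by blast
  have "v p - real N *\<^sub>R e \<in> interior L"
    unfolding int
  proof (rule CollectI, rule ballI)
    fix D assume D: "D \<in> F"
    have "r D \<le> \<bar>r D\<bar>" by simp
    also have "\<dots> \<le> (\<Sum>D\<in>F. \<bar>r D\<bar>)" using D L'(2) by (intro member_le_sum) auto
    finally have "r D < real N" using N by linarith
    then have "a D \<bullet> v p - b D < real N * (a D \<bullet> e)"
      using ae[OF D] unfolding r_def by (simp add: pos_divide_less_eq)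
    then show "a D \<bullet> (v p - real N *\<^sub>R e) < b D" by (simp add: inner_diff_right)
  qed
  moreover have "v p - real N *\<^sub>R e \<in> int_lattice"
    using P(4)[OF p] e by (auto simp: int_lattice_def)
  ultimately show False using L'(4) by blast
qed

text \<open>\<open>B\<close> contains the test points stretched from \<open>f\<close> by
  \<open>K\<close>, whereas no \<open>L\<close> with \<open>i\<close> facets and \<open>f\<close> in
  its interior contains all of them stretched by 2. There is one column for each ordered pair of
  faces.\<close>

lemma hard_instance:
  fixes K :: real
  assumes i: "2 \<le> i" "i \<le> 2 ^ (CARD('n::finite) - 1)" and K: "K > 0"
  shows "\<exists>f B R. f \<notin> int_lattice \<and> B \<in> Lfree_poly (i + 1) \<and> f \<in> interior B \<and>
    (\<forall>j<i * i. f + R j \<in> B) \<and>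
    (\<forall>L\<in>Lfree_poly i. f \<in> interior L \<longrightarrow> (\<exists>j<i * i. f + (2 / K) *\<^sub>R (R j :: real^'n) \<notin> L))"
proof -
  define l :: 'n where "l = undefined"
  define U where "U = UNIV - {l}"
  have cardU: "card U = CARD('n) - 1" by (simp add: U_def card_Diff_singleton)
  obtain P where P: "finite P" "card P = i" "cube_partition U P"
    using ex_cube_partition[of U i] i cardU by (auto simp: U_def)
  note part = cube_partitionD[OF P(3)]
  \<comment> \<open>A coordinate other than \<open>l\<close>, in which \<open>f\<close> has the
    entry 1/2, keeps \<open>f\<close> out of the lattice.\<close>
  have "U \<noteq> {}" using i cardU by (cases "U = {}") auto
  then obtain l' where l': "l' \<noteq> l" by (auto simp: U_def)
  define q where "q p = real (card (fst p)) / 2" for p :: "'n set \<times> 'n set"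
  have q_pos: "q p > 0" if "p \<in> P" for p
  proof -
    have "fst p \<noteq> {}" using cube_partition_proper[OF P(3) _ that] P(2) i by simp
    then have "card (fst p) > 0" by (simp add: card_gt_0_iff)
    then show ?thesis by (simp add: q_def)
  qed
  define n where "n = real CARD('n)"
  have n: "n \<ge> 1" unfolding n_def by (simp add: Suc_le_eq)
  have q_le: "q p \<le> n / 2" for p
    unfolding q_def n_def by (simp add: card_mono)
  \<comment> \<open>The relative depth of \<open>f\<close> below the apex. A midpoint of vertices of
    two different faces loses at least 1/2 against \<open>q r\<close>, and
    \<open>\<eta> * q r \<le> 1 / 2\<close> lets this loss pay for the depth.\<close>
  define \<eta> where "\<eta> = 1 / n"
  have \<eta>: "0 < \<eta>" "\<eta> \<le> 1" using n by (simp_all add: \<eta>_def)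
  have \<eta>q: "\<eta> * q p \<le> 1 / 2" for p
    using mult_left_mono[OF q_le, of \<eta> p] n by (simp add: \<eta>_def)
  \<comment> \<open>The apex has height \<open>1 / t\<close>. With \<open>t \<ge> K\<close>,
    stretching by \<open>K\<close> leaves the test points at most 1 below \<open>f\<close>, hence
    above the bottom facet at height -1.\<close>
  define t where "t = K + 1"
  have t: "t > 0" "K \<le> t" using K by (simp_all add: t_def)
  define \<phi> where "\<phi> = (1 - \<eta>) / t"
  have \<phi>: "\<phi> \<ge> 0" "t * \<phi> = 1 - \<eta>" using t \<eta> by (simp_all add: \<phi>_def)
  define e where "e = (axis l 1 :: real^'n)"
  have e: "e \<in> int_lattice" by (auto simp: e_def int_lattice_def axis_def)
  have e_nth: "e \<bullet> x = x $ l" for x by (simp add: e_def inner_axis')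
  define g where "g p x = face_normal p \<bullet> (x - cube_center)" for p and x :: "real^'n"
  have l_notin: "l \<notin> fst p" if "p \<in> P" for p using part(2)[OF that] by (auto simp: U_def)
  have normal_e: "face_normal p \<bullet> e = 0" if "p \<in> P" for p
    using l_notin[OF that] by (simp add: e_def inner_axis face_normal_def)
  define f where "f = cube_center + (\<phi> - 1 / 2) *\<^sub>R e"
  have f_l: "f $ l = \<phi>" by (simp add: f_def e_def cube_center_def)
  have g_f: "g p f = 0" if "p \<in> P" for p using normal_e[OF that] by (simp add: g_def f_def)
  have "f $ l' = 1 / 2" using l' by (simp add: f_def e_def cube_center_def axis_def)
  moreover have "(1 / 2 :: real) \<notin> \<int>"
    using Ints_le_or_ge[of "1 / 2" 0] by auto
  ultimately have f_notin: "f \<notin> int_lattice" unfolding int_lattice_def by (metis mem_Collect_eq)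
  define a where "a = case_option (- e) (\<lambda>p. face_normal p + (q p * t) *\<^sub>R e)"
  define b where "b = case_option 1 (\<lambda>p. q p + face_normal p \<bullet> cube_center)"
  define J where "J = insert None (Some ` P)"
  define B where "B = {x. \<forall>j\<in>J. a j \<bullet> x \<le> b j}"
  have halfspace: "a (Some p) \<bullet> x \<le> b (Some p) \<longleftrightarrow> g p x \<le> q p * (1 - t * x $ l)"
    "a (Some p) \<bullet> x < b (Some p) \<longleftrightarrow> g p x < q p * (1 - t * x $ l)"
    "b (Some p) \<le> a (Some p) \<bullet> x \<longleftrightarrow> q p * (1 - t * x $ l) \<le> g p x" for p x
    by (simp_all add: a_def b_def g_def e_nth inner_add_left inner_diff_right algebra_simps)
  have bottom: "a None \<bullet> x \<le> b None \<longleftrightarrow> - 1 \<le> x $ l" "a None \<bullet> x < b None \<longleftrightarrow> - 1 < x $ l"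
    "b None \<le> a None \<bullet> x \<longleftrightarrow> x $ l \<le> - 1" for x
    by (auto simp: a_def b_def e_nth)
  have f_strict: "a j \<bullet> f < b j" if "j \<in> J" for j
  proof (cases j)
    case None
    then show ?thesis using bottom(2) f_l \<phi>(1) by simp
  next
    case (Some p)
    then have "p \<in> P" using that unfolding J_def by auto
    then show ?thesis using q_pos \<eta>(1) unfolding Some halfspace g_f[OF \<open>p \<in> P\<close>] f_l \<phi>(2) by simp
  qed
  have B_free: "B \<in> Lfree_poly (i + 1)"
    unfolding B_def
  proof (rule Lfree_poly_halfspaces[OF _ _ f_strict])
    show "finite J" "card J \<le> i + 1"
      unfolding J_def using P(1,2) by (auto simp: card_insert_if card_image)
    show "\<exists>j\<in>J. b j \<le> a j \<bullet> z" if z: "z \<in> int_lattice" for z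
    proof -
      have "z $ l \<in> \<int>" using z by (simp add: int_lattice_def)
      then consider "z $ l \<le> - 1" | "z $ l \<ge> 0" using Ints_le_or_ge[of "z $ l" "- 1"] by auto
      then show ?thesis
      proof cases
        case 1
        then show ?thesis using bottom(3) unfolding J_def by blast
      next
        case 2
        obtain p where p: "p \<in> P" "q p \<le> g p z"
          using face_normal_lattice_cover[OF P(3) z] unfolding q_def g_def by blast
        have "q p * (1 - t * z $ l) \<le> q p * 1"
          using q_pos[OF p(1)] t(1) 2 by (intro mult_left_mono) auto
        then have "b (Some p) \<le> a (Some p) \<bullet> z" using p(2) unfolding halfspace by simp
        then show ?thesis using p(1) unfolding J_def by blast
      qed
    qed
  qed
  have f_int: "f \<in> interior B"
  proof -
    have "open {x. \<forall>j\<in>J. a j \<bullet> x < b j}"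
    proof -
      have "{x. \<forall>j\<in>J. a j \<bullet> x < b j} = (\<Inter>j\<in>J. {x. a j \<bullet> x < b j})" by auto
      then show ?thesis using P(1) by (auto simp: J_def intro!: open_INT open_halfspace_lt)
    qed
    then show ?thesis
      using f_strict unfolding B_def by (intro interiorI[of "{x. \<forall>j\<in>J. a j \<bullet> x < b j}"]) (auto intro: less_imp_le)
  qed
  \<comment> \<open>Chosen so that \<open>\<phi> + \<tau> = 1 / t\<close>: such a descent relaxes
    the facet of \<open>p\<close> by exactly \<open>q p\<close>, so the ray from \<open>f\<close> to
    \<open>cube_vertex p - \<tau> *\<^sub>R e\<close> is parallel to it.\<close>
  define \<tau> where "\<tau> = \<eta> / t"
  have \<tau>: "\<tau> > 0" "t * \<tau> = \<eta>" using \<eta> t by (simp_all add: \<tau>_def)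
  define m where "m p p' = (1/2) *\<^sub>R (cube_vertex p + cube_vertex p') - (if p = p' then \<tau> else 0) *\<^sub>R e"
    for p p' :: "'n set \<times> 'n set"
  have vertex_l: "cube_vertex p $ l = 0" if "p \<in> P" for p
    using l_notin[OF that] part(1)[OF that] by (auto simp: cube_vertex_def)
  have in_B: "f + K *\<^sub>R (m p p' - f) \<in> B" if pp: "p \<in> P" "p' \<in> P" for p p'
  proof -
    define \<sigma> where "\<sigma> = (if p = p' then \<tau> else 0)"
    have \<sigma>: "0 \<le> \<sigma>" "\<sigma> \<le> \<tau>" using \<tau> by (auto simp: \<sigma>_def)
    let ?x = "f + K *\<^sub>R (m p p' - f)"
    have x_l: "?x $ l = \<phi> - K * (\<sigma> + \<phi>)"
      using vertex_l pp by (simp add: m_def f_l e_def \<sigma>_def[symmetric] algebra_simps)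
    have "t * (\<sigma> + \<phi>) \<le> t * \<tau> + t * \<phi>" using \<sigma> t by (simp add: distrib_left)
    then have t1: "t * (\<sigma> + \<phi>) \<le> 1" unfolding \<tau>(2) \<phi>(2) by simp
    have "K * (\<sigma> + \<phi>) \<le> t * (\<sigma> + \<phi>)" using t \<sigma> \<phi> by (intro mult_right_mono) auto
    then have "- 1 \<le> ?x $ l" using t1 \<phi>(1) unfolding x_l by linarith
    moreover have "g r ?x \<le> q r * (1 - t * ?x $ l)" if r: "r \<in> P" for r
    proof -
      have "g r ?x = (1 - K) * g r f + K * g r (m p p')"
        by (simp add: g_def inner_add_right inner_diff_right algebra_simps)
      moreover have "g r (m p p') = (g r (cube_vertex p) + g r (cube_vertex p')) / 2"
        using normal_e[OF r] by (simp add: g_def m_def inner_add_right inner_diff_right)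
      ultimately have gx: "g r ?x = K * ((g r (cube_vertex p) + g r (cube_vertex p')) / 2)"
        using g_f[OF r] by simp
      have own: "g r (cube_vertex r) = q r"
        unfolding g_def q_def by (rule face_normal_own_vertex)
      have other: "g r (cube_vertex s) \<le> q r - 1" if "s \<in> P" "s \<noteq> r" for s
        unfolding g_def q_def using face_normal_other_vertex[OF P(3) that(1) r that(2)] .
      have any: "g r (cube_vertex s) \<le> q r" if "s \<in> P" for s
        using own other[OF that] by (cases "s = r") auto
      have "(g r (cube_vertex p) + g r (cube_vertex p')) / 2 \<le> q r * (t * \<sigma> + (1 - \<eta>))"
      proof (cases "p = p'")
        case True
        then have "t * \<sigma> + (1 - \<eta>) = 1" using \<tau>(2) by (simp add: \<sigma>_def)
        then show ?thesis using any[OF pp(1)] True by simp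
      next
        case False
        have "g r (cube_vertex p) + g r (cube_vertex p') \<le> 2 * q r - 1"
        proof (cases "p = r")
          case True
          then show ?thesis using any[OF pp(1)] other[OF pp(2)] False by simp
        next
          case False
          then show ?thesis using other[OF pp(1)] any[OF pp(2)] by simp
        qed
        moreover have "q r * (1 - \<eta>) \<ge> q r - 1 / 2"
          using \<eta>q[of r] by (simp add: algebra_simps)
        ultimately show ?thesis using False by (simp add: \<sigma>_def)
      qed
      then have "g r ?x \<le> K * (q r * (t * \<sigma> + (1 - \<eta>)))"
        unfolding gx using K by (intro mult_left_mono) auto
      also have "\<dots> \<le> \<eta> * q r + K * (q r * (t * \<sigma> + (1 - \<eta>)))"
        using \<eta> q_pos[OF r] by simp
      also have "\<dots> = q r * (1 - t * \<phi> + K * (t * \<sigma> + t * \<phi>))"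
        unfolding \<phi>(2) by (simp add: algebra_simps)
      also have "\<dots> = q r * (1 - t * ?x $ l)"
        unfolding x_l by (simp add: algebra_simps)
      finally show ?thesis .
    qed
    ultimately show ?thesis
      unfolding B_def J_def using halfspace(1) bottom(1) by auto
  qed
  have "card (P \<times> P) = i * i" using P(2) by (simp add: card_cartesian_product)
  then obtain h where h: "bij_betw h {0..<i * i} (P \<times> P)"
    using ex_bij_betw_nat_finite[of "P \<times> P"] P(1) by auto
  define R where "R j = K *\<^sub>R (m (fst (h j)) (snd (h j)) - f)" for j
  have "f + R j \<in> B" if "j < i * i" for j
  proof -
    have "h j \<in> P \<times> P" using bij_betwE[OF h] that by auto
    then show ?thesis unfolding R_def by (intro in_B) auto
  qed
  moreover have "\<exists>j<i * i. f + (2 / K) *\<^sub>R R j \<notin> L" if L: "L \<in> Lfree_poly i" "f \<in> interior L" for L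
  proof -
    have "P \<noteq> {}" using P(2) i by auto
    have "\<exists>p\<in>P. \<exists>p'\<in>P. f + 2 *\<^sub>R (m p p' - f) \<notin> L"
      by (rule few_facets_miss_point[OF L P(1,2) \<open>P \<noteq> {}\<close>, where v = cube_vertex and e = e and \<tau> = \<tau>])
        (simp_all add: cube_vertex_lattice e \<tau> m_def scaleR_2[symmetric])
    then obtain p p' where pp: "(p, p') \<in> P \<times> P" "f + 2 *\<^sub>R (m p p' - f) \<notin> L"
      by blast
    have "(p, p') \<in> h ` {0..<i * i}"
      using bij_betw_imp_surj_on[OF h] pp(1) by simp
    then obtain j where j: "j < i * i" "h j = (p, p')"
      by auto
    have "(2 / K) *\<^sub>R R j = 2 *\<^sub>R (m p p' - f)"
      using K j(2) by (simp add: R_def)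
    then have "f + (2 / K) *\<^sub>R R j \<notin> L" using pp(2) by simp
    then show ?thesis using j(1) by blast
  qed
  ultimately show ?thesis using f_notin B_free f_int by blast
qed

text \<open>The vector with entry \<delta> in all columns meets every condition from
  \<open>Lfree_poly i\<close>, since a missed point has gauge at least \<open>1 / \<delta>\<close>.
  The gauges of \<open>B\<close> are at most 1, so membership after scaling forces
  \<open>1 \<le> \<alpha> * \<delta> * N\<close>, which bounds \<alpha> below by
  \<open>2 * M\<close>.\<close>

lemma rho_Lfree_poly_infinite:
  assumes i: "2 \<le> i" "i \<le> 2 ^ (CARD('n::finite) - 1)"
  shows "rho (Lfree_poly i :: (real^'n) set set) (Lfree_poly (i + 1)) = \<infinity>"
proof (rule ereal_top)
  fix M' :: real
  define M where "M = max M' 1"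
  have M: "M > 0" "M' \<le> M" by (simp_all add: M_def)
  define N where "N = real (i * i)"
  have N: "N > 0" using i by (simp add: N_def)
  define \<delta> where "\<delta> = 1 / (2 * M * N)"
  have \<delta>: "\<delta> > 0" using M N by (simp add: \<delta>_def)
  obtain f :: "real^'n" and B R where f: "f \<notin> int_lattice" "f \<in> interior B" and B: "B \<in> Lfree_poly (i + 1)"
    and R: "\<And>j. j < i * i \<Longrightarrow> f + R j \<in> B"
    and miss: "\<And>L. L \<in> Lfree_poly i \<Longrightarrow> f \<in> interior L \<Longrightarrow> \<exists>j<i * i. f + \<delta> *\<^sub>R R j \<notin> L"
  proof -
    have "2 / (2 / \<delta>) = \<delta>" "2 / \<delta> > 0" using \<delta> by simp_all
    with hard_instance[OF i, of "2 / \<delta>"] obtain f :: "real^'n" and B R where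
      "f \<notin> int_lattice \<and> B \<in> Lfree_poly (i + 1) \<and> f \<in> interior B \<and> (\<forall>j<i * i. f + R j \<in> B) \<and>
       (\<forall>L\<in>Lfree_poly i. f \<in> interior L \<longrightarrow> (\<exists>j<i * i. f + \<delta> *\<^sub>R R j \<notin> L))"
      by metis
    then show thesis by (intro that[of f B R]) simp_all
  qed
  have "ereal M \<le> rho_f (Lfree_poly i) (Lfree_poly (i + 1)) f"
    unfolding rho_f_def
  proof (rule Inf_greatest, clarify)
    fix \<alpha> :: real
    assume \<alpha>: "0 < \<alpha>" and sub: "\<forall>k R. C_fam (Lfree_poly i) k R f
        \<subseteq> (\<lambda>s j. s j / \<alpha>) ` C_fam (Lfree_poly (i + 1)) k R f"
    define s where "s j = (if j < i * i then \<delta> else 0)" for j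
    have nn: "s \<in> nonneg_orthant (i * i)"
      using \<delta> by (auto simp: s_def nonneg_orthant_def)
    have "s \<in> C_set L (i * i) R f" if L: "L \<in> Lfree_poly i" for L
    proof (cases "f \<in> interior L")
      case True
      then obtain j where j: "j < i * i" "f + \<delta> *\<^sub>R R j \<notin> L" using miss[OF L] by blast
      have "convex L" using L unfolding Lfree_poly_def lattice_free_def full_closed_convex_def by blast
      then have "1 / \<delta> \<le> gauge_fn ((\<lambda>x. x - f) ` L) (R j)"
        using True \<delta> j(2) by (intro gauge_fn_ge) auto
      then have "1 \<le> s j * gauge_fn ((\<lambda>x. x - f) ` L) (R j)"
        using \<delta> j(1) by (simp add: s_def pos_divide_le_eq mult.commute)
      also have "\<dots> \<le> (\<Sum>j<i * i. s j * gauge_fn ((\<lambda>x. x - f) ` L) (R j))"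
        using j(1) \<delta> gauge_fn_nonneg[OF True]
        by (intro member_le_sum[of j "{..<i * i}" "\<lambda>j. s j * gauge_fn ((\<lambda>x. x - f) ` L) (R j)"])
          (auto simp: s_def)
      finally show ?thesis using nn True by (simp add: C_set_def)
    qed (use nn in \<open>simp add: C_set_def\<close>)
    then have "s \<in> C_fam (Lfree_poly i) (i * i) R f" using nn by (simp add: C_fam_def)
    then obtain s' where s': "s' \<in> C_fam (Lfree_poly (i + 1)) (i * i) R f" "s = (\<lambda>j. s' j / \<alpha>)"
      using sub by blast
    have s'_eq: "s' j = \<alpha> * s j" for j using s'(2) \<alpha> by simp
    have "s' \<in> C_set B (i * i) R f" using s'(1) B unfolding C_fam_def by blast
    then have "1 \<le> (\<Sum>j<i * i. s' j * gauge_fn ((\<lambda>x. x - f) ` B) (R j))"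
      using f(2) by (simp add: C_set_def)
    also have "\<dots> \<le> (\<Sum>j<i * i. \<alpha> * \<delta>)"
    proof (rule sum_mono)
      fix j assume "j \<in> {..<i * i}"
      then have j: "j < i * i" by simp
      have "\<alpha> * \<delta> * gauge_fn ((\<lambda>x. x - f) ` B) (R j) \<le> \<alpha> * \<delta> * 1"
        using gauge_fn_le[OF R[OF j]] \<alpha> \<delta> by (intro mult_left_mono) auto
      then show "s' j * gauge_fn ((\<lambda>x. x - f) ` B) (R j) \<le> \<alpha> * \<delta>"
        using j by (simp add: s'_eq s_def)
    qed
    also have "\<dots> = N * (\<alpha> * \<delta>)" by (simp add: N_def)
    also have "\<dots> = \<alpha> / (2 * M)" using N by (simp add: \<delta>_def)
    finally have "2 * M \<le> \<alpha>" using M by (simp add: pos_le_divide_eq)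
    then show "ereal M \<le> ereal \<alpha>" using M by simp
  qed
  also have "\<dots> \<le> rho (Lfree_poly i :: (real^'n) set set) (Lfree_poly (i + 1))"
    unfolding rho_def using f(1) by (intro SUP_upper) auto
  finally show "ereal M' \<le> rho (Lfree_poly i :: (real^'n) set set) (Lfree_poly (i + 1))"
    using M(2) by (meson ereal_less_eq(3) order_trans)
qed

theorem theorem2p1:
  fixes i :: nat
  assumes "2 \<le> i" and "i \<le> 2 ^ CARD('n::finite)"
  shows "(i \<le> 2 ^ (CARD('n) - 1) \<longrightarrow>
            rho (Lfree_poly i :: (real^'n) set set) (Lfree_poly (i + 1)) = \<infinity>)
       \<and> (i > 2 ^ (CARD('n) - 1) \<longrightarrow>
            rho (Lfree_poly i :: (real^'n) set set) Lfree_poly_all \<le> 4 * Flt TYPE('n))"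
  using rho_Lfree_poly_infinite[OF assms(1), where 'n = 'n] rho_le_Flt[where 'n = 'n and i = i] by blast

end
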